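(* Let $n\ge 3$ and let $A$ be a commutative ring. The assignment $y_\alpha^a\mapsto x_\alpha^a\, y_\alpha$ ($\alpha\in\Delta$, $a\in A$) induces a group isomorphism $$\phi: Br(D_n,A)\longrightarrow St(D_n,A)\rtimes Br(D_n).$$
   Context: The root system $D_n$ consists of the vectors $\pm\epsilon_i\pm\epsilon_j$ ($1\le i\ne j\le n$) in $\mathbb R^n$. Fix the simple system $\Delta=\{\alpha_2,\alpha_{2'},\alpha_3,\dots,\alpha_n\}$ with $\alpha_i=-\epsilon_{i-1}+\epsilon_i$ ($2\le i\le n$) and $\alpha_{2'}=\epsilon_1+\epsilon_2$. Two simple roots are adjacent (in the Dynkin diagram) exactly for the pairs $\{\alpha_2,\alpha_3\}$, $\{\alpha_{2'},\alpha_3\}$, $\{\alpha_k,\alpha_{k+1}\}$ ($3\le k\le n-1$); these are ordered by $\alpha_2<\alpha_3<\dots<\alpha_n$ and $\alpha_{2'}<\alpha_3$. $Br(D_n,A)$ is the group generated by $y_\alpha^a$, $\alpha\in\Delta$, $a\in A$, with relations for $a,b,c\in A$: (A1) $y_\alpha^a y_\alpha^0 y_\alpha^b = y_\alpha^0 y_\alpha^0 y_\alpha^{a+b}$; (A1$\times$A1) $y_\alpha^a y_\beta^b=y_\beta^b y_\alpha^a$ if $\alpha\ne\beta$ are not adjacent; (A2) $y_\alpha^a y_\beta^b y_\alpha^c = y_\beta^c y_\alpha^{b+ac} y_\beta^a$ if $\alpha,\beta$ are adjacent and $\alpha<\beta$. $Br(D_n)=Br(D_n,0)$ is the braid group with generators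 $y_\alpha$ ($\alpha\in\Delta$), relations $y_\alpha y_\beta=y_\beta y_\alpha$ for non-adjacent $\alpha\neq\beta$ and $y_\alpha y_\beta y_\alpha=y_\beta y_\alpha y_\beta$ for adjacent ones; it maps onto the Weyl group $W(D_n)$ by $y_\alpha\mapsto\sigma_\alpha$ (the reflection in $\alpha$). $St(D_n,A)$ is generated by $x_\alpha^a$, $\alpha\in D_n$, $a\in A$, with relations: $x_\alpha^a x_\alpha^b=x_\alpha^{a+b}$; $x_\alpha^a x_\beta^b = x_\beta^b x_\alpha^a$ if $\alpha+\beta\notin D_n$ and $\alpha+\beta\ne0$; $x_\alpha^a x_\beta^b = x_\beta^b x_{\alpha+\beta}^{ab} x_\alpha^a$ if $\alpha+\beta\in D_n$. $W(D_n)$, hence $Br(D_n)$, acts on $St(D_n,A)$ by $\sigma\cdot x_\alpha^a = x_{\sigma(\alpha)}^a$, and the semidirect product is taken for this action. *)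

theory Defs
  imports "HOL-Algebra.Group"
begin

text \<open>A letter is a generator together with an exponent sign
  (True = the generator, False = its inverse).  Words are lists of letters.\<close>

type_synonym 'g word = "('g \<times> bool) list"

definition words_on :: "'g set \<Rightarrow> 'g word set" where
  "words_on S = {w. \<forall>x\<in>set w. fst x \<in> S}"

inductive pres_eq :: "'g set \<Rightarrow> ('g word \<times> 'g word) set \<Rightarrow> 'g word \<Rightarrow> 'g word \<Rightarrow> bool"
  for S R where
  pe_refl: "w \<in> words_on S \<Longrightarrow> pres_eq S R w w"
| pe_sym: "pres_eq S R u v \<Longrightarrow> pres_eq S R v u"
| pe_trans: "pres_eq S R u v \<Longrightarrow> pres_eq S R v w \<Longrightarrow> pres_eq S R u w"
| pe_cancel: "u \<in> words_on S \<Longrightarrow> v \<in> words_on S \<Longrightarrow> g \<in> S \<Longrightarrow>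
     pres_eq S R (u @ [(g, b), (g, \<not> b)] @ v) (u @ v)"
| pe_rel: "u \<in> words_on S \<Longrightarrow> v \<in> words_on S \<Longrightarrow> (l, r) \<in> R \<Longrightarrow>
     l \<in> words_on S \<Longrightarrow> r \<in> words_on S \<Longrightarrow> pres_eq S R (u @ l @ v) (u @ r @ v)"

definition pclass :: "'g set \<Rightarrow> ('g word \<times> 'g word) set \<Rightarrow> 'g word \<Rightarrow> 'g word set" where
  "pclass S R w = {v. pres_eq S R w v}"

definition presented_group :: "'g set \<Rightarrow> ('g word \<times> 'g word) set \<Rightarrow> 'g word set monoid" where
  "presented_group S R =
     \<lparr> carrier = pclass S R ` words_on S,
       mult = (\<lambda>X Y. \<Union>u\<in>X. \<Union>v\<in>Y. pclass S R (u @ v)),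
       one = pclass S R [] \<rparr>"

definition pgen :: "'g set \<Rightarrow> ('g word \<times> 'g word) set \<Rightarrow> 'g \<Rightarrow> 'g word set" where
  "pgen S R g = pclass S R [(g, True)]"

definition pw :: "'g list \<Rightarrow> 'g word" where
  "pw gs = map (\<lambda>g. (g, True)) gs"

definition semidirect ::
  "('a, 'c) monoid_scheme \<Rightarrow> ('b, 'd) monoid_scheme \<Rightarrow> ('b \<Rightarrow> 'a \<Rightarrow> 'a) \<Rightarrow> ('a \<times> 'b) monoid" where
  "semidirect G H act =
     \<lparr> carrier = carrier G \<times> carrier H,
       mult = (\<lambda>(g, h) (g', h'). (g \<otimes>\<^bsub>G\<^esub> act h g', h \<otimes>\<^bsub>H\<^esub> h')),
       one = (\<one>\<^bsub>G\<^esub>, \<one>\<^bsub>H\<^esub>) \<rparr>"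

text \<open>Vectors of \<open>\<real>\<^sup>n\<close> with integer coordinates (all roots have integer
  coordinates), represented as functions on the indices 1..n (zero elsewhere).\<close>

type_synonym vec = "nat \<Rightarrow> int"

definition eps :: "nat \<Rightarrow> vec" where
  "eps i = (\<lambda>k. if k = i then 1 else 0)"

definition vadd :: "vec \<Rightarrow> vec \<Rightarrow> vec" where
  "vadd u v = (\<lambda>k. u k + v k)"

definition vsmult :: "int \<Rightarrow> vec \<Rightarrow> vec" where
  "vsmult c v = (\<lambda>k. c * v k)"

definition vzero :: vec where
  "vzero = (\<lambda>_. 0)"

definition ip :: "nat \<Rightarrow> vec \<Rightarrow> vec \<Rightarrow> int" where
  "ip n u v = (\<Sum>k\<in>{1..n}. u k * v k)"

definition Dn :: "nat \<Rightarrow> vec set" where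
  "Dn n = {vadd (vsmult s (eps i)) (vsmult t (eps j)) | i j s t.
             1 \<le> i \<and> i \<le> n \<and> 1 \<le> j \<and> j \<le> n \<and> i \<noteq> j \<and> s \<in> {1, -1} \<and> t \<in> {1, -1}}"

text \<open>Reflection in a root alpha (note that ip alpha alpha = 2 for roots).\<close>
definition refl :: "nat \<Rightarrow> vec \<Rightarrow> vec \<Rightarrow> vec" where
  "refl n \<alpha> v = (\<lambda>k. v k - ip n v \<alpha> * \<alpha> k)"

definition alpha :: "nat \<Rightarrow> vec" where
  "alpha i = vadd (vsmult (-1) (eps (i - 1))) (eps i)"

definition alpha2' :: vec where
  "alpha2' = vadd (eps 1) (eps 2)"

definition Delta :: "nat \<Rightarrow> vec set" where
  "Delta n = insert alpha2' (alpha ` {2..n})"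

text \<open>adj_lt n a b: a and b are adjacent in the Dynkin diagram and a < b.\<close>
definition adj_lt :: "nat \<Rightarrow> vec \<Rightarrow> vec \<Rightarrow> bool" where
  "adj_lt n a b \<longleftrightarrow>
     (a = alpha 2 \<and> b = alpha 3) \<or> (a = alpha2' \<and> b = alpha 3) \<or>
     (\<exists>k. 3 \<le> k \<and> k \<le> n - 1 \<and> a = alpha k \<and> b = alpha (k + 1))"

definition adjacent :: "nat \<Rightarrow> vec \<Rightarrow> vec \<Rightarrow> bool" where
  "adjacent n a b \<longleftrightarrow> adj_lt n a b \<or> adj_lt n b a"

definition BrA_gens :: "nat \<Rightarrow> (vec \<times> 'a) set" where
  "BrA_gens n = Delta n \<times> UNIV"

definition BrA_rels :: "nat \<Rightarrow> ((vec \<times> 'a::comm_ring_1) word \<times> (vec \<times> 'a) word) set" where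
  "BrA_rels n =
     {(pw [(\<alpha>, a), (\<alpha>, 0), (\<alpha>, b)], pw [(\<alpha>, 0), (\<alpha>, 0), (\<alpha>, a + b)]) | \<alpha> a b.
        \<alpha> \<in> Delta n}
   \<union> {(pw [(\<alpha>, a), (\<beta>, b)], pw [(\<beta>, b), (\<alpha>, a)]) | \<alpha> \<beta> a b.
        \<alpha> \<in> Delta n \<and> \<beta> \<in> Delta n \<and> \<alpha> \<noteq> \<beta> \<and> \<not> adjacent n \<alpha> \<beta>}
   \<union> {(pw [(\<alpha>, a), (\<beta>, b), (\<alpha>, c)], pw [(\<beta>, c), (\<alpha>, b + a * c), (\<beta>, a)]) | \<alpha> \<beta> a b c.
        \<alpha> \<in> Delta n \<and> \<beta> \<in> Delta n \<and> adj_lt n \<alpha> \<beta>}"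

definition BrA :: "nat \<Rightarrow> (vec \<times> 'a::comm_ring_1) word set monoid" where
  "BrA n = presented_group (BrA_gens n) (BrA_rels n)"

definition Br_rels :: "nat \<Rightarrow> (vec word \<times> vec word) set" where
  "Br_rels n =
     {(pw [\<alpha>, \<beta>], pw [\<beta>, \<alpha>]) | \<alpha> \<beta>.
        \<alpha> \<in> Delta n \<and> \<beta> \<in> Delta n \<and> \<alpha> \<noteq> \<beta> \<and> \<not> adjacent n \<alpha> \<beta>}
   \<union> {(pw [\<alpha>, \<beta>, \<alpha>], pw [\<beta>, \<alpha>, \<beta>]) | \<alpha> \<beta>.
        \<alpha> \<in> Delta n \<and> \<beta> \<in> Delta n \<and> adjacent n \<alpha> \<beta>}"

definition Br :: "nat \<Rightarrow> vec word set monoid" where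
  "Br n = presented_group (Delta n) (Br_rels n)"

definition St_gens :: "nat \<Rightarrow> (vec \<times> 'a) set" where
  "St_gens n = Dn n \<times> UNIV"

definition St_rels :: "nat \<Rightarrow> ((vec \<times> 'a::comm_ring_1) word \<times> (vec \<times> 'a) word) set" where
  "St_rels n =
     {(pw [(\<alpha>, a), (\<alpha>, b)], pw [(\<alpha>, a + b)]) | \<alpha> a b. \<alpha> \<in> Dn n}
   \<union> {(pw [(\<alpha>, a), (\<beta>, b)], pw [(\<beta>, b), (\<alpha>, a)]) | \<alpha> \<beta> a b.
        \<alpha> \<in> Dn n \<and> \<beta> \<in> Dn n \<and> vadd \<alpha> \<beta> \<notin> Dn n \<and> vadd \<alpha> \<beta> \<noteq> vzero}
   \<union> {(pw [(\<alpha>, a), (\<beta>, b)], pw [(\<beta>, b), (vadd \<alpha> \<beta>, a * b), (\<alpha>, a)]) | \<alpha> \<beta> a b.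
        \<alpha> \<in> Dn n \<and> \<beta> \<in> Dn n \<and> vadd \<alpha> \<beta> \<in> Dn n}"

definition St :: "nat \<Rightarrow> (vec \<times> 'a::comm_ring_1) word set monoid" where
  "St n = presented_group (St_gens n) (St_rels n)"

text \<open>Image in the Weyl group of a braid word: y_alpha \<mapsto> sigma_alpha
  (reflections are involutions, so inverse letters map to the same reflection).\<close>
definition weyl_of :: "nat \<Rightarrow> vec word \<Rightarrow> vec \<Rightarrow> vec" where
  "weyl_of n w = foldr (\<lambda>x f. refl n (fst x) \<circ> f) w id"

definition act_word :: "(vec \<Rightarrow> vec) \<Rightarrow> (vec \<times> 'a) word \<Rightarrow> (vec \<times> 'a) word" where
  "act_word \<sigma> v = map (\<lambda>((\<gamma>, a), e). ((\<sigma> \<gamma>, a), e)) v"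

text \<open>Action of an element B of Br(D_n) on an element X of St(D_n,A):
  apply the Weyl element of (any) representative of B to (any) representative of X.\<close>
definition br_act :: "nat \<Rightarrow> vec word set \<Rightarrow> (vec \<times> 'a::comm_ring_1) word set \<Rightarrow> (vec \<times> 'a) word set" where
  "br_act n B X = (\<Union>w\<in>B. \<Union>v\<in>X. pclass (St_gens n) (St_rels n) (act_word (weyl_of n w) v))"

definition StBr :: "nat \<Rightarrow> ((vec \<times> 'a::comm_ring_1) word set \<times> vec word set) monoid" where
  "StBr n = semidirect (St n) (Br n) (br_act n)"

end

theory Submission
  imports Defs
begin

text \<open>
  In \<open>Br(D\<^sub>n,A)\<close> put \<open>y\<^sub>\<alpha> = y\<^sub>\<alpha>\<^sup>0\<close> and \<open>x\<^sub>\<alpha>\<^sup>a = y\<^sub>\<alpha>\<^sup>a y\<^sub>\<alpha>\<^sup>-\<^sup>1\<close>. The relations give braid relations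
  for the \<open>y\<^sub>\<alpha>\<close>, and conjugation by \<open>y\<^sub>\<alpha>\<close> moves the \<open>x\<^sub>\<beta>\<^sup>a\<close> (\<open>\<beta>\<close> simple) as the reflection \<open>\<sigma>\<^sub>\<alpha>\<close> moves
  \<open>\<beta>\<close>. By induction on the height, the conjugates of the \<open>x\<^sub>\<alpha>\<^sup>a\<close> depend only on the root they
  belong to, which yields elements \<open>x\<^sub>\<gamma>\<^sup>a\<close> for all roots, permuted by the braid group through
  its Weyl group. The Steinberg relations for an arbitrary pair of roots then follow from those
  for pairs of simple roots by transitivity of the Weyl group. Every ordered
  pair of roots with inner product \<open>-1\<close> is conjugate to \<open>(\<alpha>\<^sub>2, \<alpha>\<^sub>3)\<close> or \<open>(\<alpha>\<^sub>2\<^sub>', \<alpha>\<^sub>3)\<close>, so the commutator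
  relation holds in both orders, without signs.
  This gives the inverse \<open>St(D\<^sub>n,A) \<rtimes> Br(D\<^sub>n) \<rightarrow> Br(D\<^sub>n,A)\<close>.
\<close>

section \<open>Presented groups and semidirect products\<close>

text \<open>Conjugation by \<open>y_\<alpha>\<close> satisfies the braid relations, but its square
  need not be the identity, so the Weyl group does not act on the whole group in this way. That the
  conjugates depend only on the root is therefore a real claim, and its induction must also carry
  the triviality of certain squares.

  The input about simple roots comes from setting parameters to 0. In (A2), one free parameter gives
  the action of the \<open>y\<close>'s on the \<open>x\<close>'s; two give the commutator formula,
  or the commutation of \<open>x_\<beta>\<close> with \<open>x_(\<alpha>+\<beta>)\<close>. In (A1),
  it shows that \<open>y_\<alpha>\<close> squared commutes with \<open>x_\<alpha>\<close>. This is
  what happens at a change of sign: the element at \<open>-\<alpha>\<close> has to be the conjugate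
  of \<open>x_\<alpha>\<close> by \<open>y_\<alpha>\<close>, and a second conjugation must lead
  back.

  The missing signs are consistent. Since \<open>x_(\<alpha>+\<beta>)\<close> commutes with
  \<open>x_\<alpha>\<close> and \<open>x_\<beta>\<close>, the commutator formula in both orders
  forces the element of \<open>\<alpha>+\<beta>\<close> with parameter \<open>2ab\<close> to be
  trivial.\<close>

lemma words_on_Nil [simp]: "[] \<in> words_on S"
  and words_on_Cons [simp]: "x # w \<in> words_on S \<longleftrightarrow> fst x \<in> S \<and> w \<in> words_on S"
  and words_on_append [simp]: "u @ v \<in> words_on S \<longleftrightarrow> u \<in> words_on S \<and> v \<in> words_on S"
  by (auto simp: words_on_def)

lemma words_on_pw [simp]: "pw gs \<in> words_on S \<longleftrightarrow> set gs \<subseteq> S"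
  by (auto simp: words_on_def pw_def)

lemma pres_eq_words_on: "pres_eq S R u v \<Longrightarrow> u \<in> words_on S \<and> v \<in> words_on S"
  by (induction rule: pres_eq.induct) auto

lemma pres_eq_context:
  assumes "pres_eq S R u v" "p \<in> words_on S" "q \<in> words_on S"
  shows "pres_eq S R (p @ u @ q) (p @ v @ q)"
  using assms(1)
proof (induction rule: pres_eq.induct)
  case (pe_cancel u v g b)
  then show ?case
    using pres_eq.pe_cancel[of "p @ u" S "v @ q" g R b] assms by simp
next
  case (pe_rel u v l r)
  then show ?case
    using pres_eq.pe_rel[of "p @ u" S "v @ q" l r R] assms by simp
next
  case (pe_refl w)
  then show ?case using assms by (simp add: pres_eq.pe_refl)
next
  case (pe_sym u v)
  then show ?case by (blast intro: pres_eq.pe_sym)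
next
  case (pe_trans u v w)
  show ?case by (rule pres_eq.pe_trans[OF pe_trans.IH])
qed

lemma pres_eq_append:
  assumes "pres_eq S R u u'" "pres_eq S R v v'"
  shows "pres_eq S R (u @ v) (u' @ v')"
proof -
  have "pres_eq S R (u @ v) (u' @ v)"
    using pres_eq_context[OF assms(1), of "[]" v] pres_eq_words_on[OF assms(2)] by simp
  moreover have "pres_eq S R (u' @ v) (u' @ v')"
    using pres_eq_context[OF assms(2), of u' "[]"] pres_eq_words_on[OF assms(1)] by simp
  ultimately show ?thesis by (rule pe_trans)
qed

lemma pclass_eqI: "pres_eq S R u v \<Longrightarrow> pclass S R u = pclass S R v"
  unfolding pclass_def by (intro Collect_cong iffI) (erule (1) pe_trans[OF pe_sym] pe_trans)+

lemma pclass_self: "w \<in> words_on S \<Longrightarrow> w \<in> pclass S R w"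
  by (simp add: pclass_def pe_refl)

lemma pclass_rel:
  "(l, r) \<in> R \<Longrightarrow> l \<in> words_on S \<Longrightarrow> r \<in> words_on S \<Longrightarrow> pclass S R l = pclass S R r"
  using pe_rel[of "[]" S "[]" l r R] by (intro pclass_eqI) simp

text \<open>The product is a union over all pairs of representatives. By congruence its members are
  one and the same class, and the union is that class because both index sets are non-empty.\<close>

lemma presented_mult:
  assumes "u \<in> words_on S" "v \<in> words_on S"
  shows "pclass S R u \<otimes>\<^bsub>presented_group S R\<^esub> pclass S R v = pclass S R (u @ v)"
proof -
  have "pclass S R (u' @ v') = pclass S R (u @ v)"
    if "u' \<in> pclass S R u" "v' \<in> pclass S R v" for u' v'
  proof -
    have "pres_eq S R u u'" "pres_eq S R v v'"
      using that by (simp_all add: pclass_def)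
    then show ?thesis
      by (intro pclass_eqI[symmetric] pres_eq_append)
  qed
  then have "(\<Union>u'\<in>pclass S R u. \<Union>v'\<in>pclass S R v. pclass S R (u' @ v')) =
      (\<Union>u'\<in>pclass S R u. \<Union>v'\<in>pclass S R v. pclass S R (u @ v))"
    by (intro SUP_cong HOL.refl)
  also have "\<dots> = pclass S R (u @ v)"
    using assms[THEN pclass_self, of R] by auto
  finally show ?thesis
    by (simp add: presented_group_def)
qed

lemma presented_carrier: "carrier (presented_group S R) = pclass S R ` words_on S"
  and presented_one: "\<one>\<^bsub>presented_group S R\<^esub> = pclass S R []"
  by (simp_all add: presented_group_def)

lemma pclass_in_carrier [simp]:
  "w \<in> words_on S \<Longrightarrow> pclass S R w \<in> carrier (presented_group S R)"
  by (simp add: presented_carrier)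

definition winv :: "'g word \<Rightarrow> 'g word" where
  "winv w = rev (map (\<lambda>(g, b). (g, \<not> b)) w)"

lemma words_on_winv: "w \<in> words_on S \<Longrightarrow> winv w \<in> words_on S"
  by (auto simp: winv_def words_on_def)

lemma pres_eq_winv: "w \<in> words_on S \<Longrightarrow> pres_eq S R (winv w @ w) []"
proof (induction w)
  case Nil
  then show ?case by (simp add: winv_def pe_refl)
next
  case (Cons x w)
  obtain g b where x: "x = (g, b)" by (cases x)
  have "pres_eq S R (winv w @ [(g, \<not> b), (g, \<not> \<not> b)] @ w) (winv w @ w)"
    using Cons.prems x by (intro pe_cancel) (auto simp: words_on_winv)
  then show ?case
    using pe_trans[OF _ Cons.IH] Cons.prems x by (simp add: winv_def)
qed

lemma group_presented [simp]: "group (presented_group S R)"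
proof (rule groupI)
  fix x
  assume "x \<in> carrier (presented_group S R)"
  then obtain w where w: "w \<in> words_on S" "x = pclass S R w"
    by (auto simp: presented_carrier)
  show "\<exists>y\<in>carrier (presented_group S R). y \<otimes>\<^bsub>presented_group S R\<^esub> x = \<one>\<^bsub>presented_group S R\<^esub>"
    using w by (intro bexI[of _ "pclass S R (winv w)"])
      (auto simp: presented_mult presented_one words_on_winv pclass_eqI[OF pres_eq_winv])
qed (auto simp: presented_carrier presented_one presented_mult)

lemma pgen_in_carrier [simp]: "g \<in> S \<Longrightarrow> pgen S R g \<in> carrier (presented_group S R)"
  by (simp add: pgen_def)

lemma pclass_letter_False:
  assumes "g \<in> S"
  shows "pclass S R [(g, False)] = inv\<^bsub>presented_group S R\<^esub> (pgen S R g)"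
proof (rule group.inv_equality[symmetric])
  have "pres_eq S R ([] @ [(g, False), (g, \<not> False)] @ []) ([] @ [])"
    using assms by (intro pe_cancel) auto
  then show "pclass S R [(g, False)] \<otimes>\<^bsub>presented_group S R\<^esub> pgen S R g = \<one>\<^bsub>presented_group S R\<^esub>"
    using assms by (simp add: pgen_def presented_mult presented_one pclass_eqI)
qed (use assms in auto)

lemma pclass_Cons:
  assumes "fst x \<in> S" "w \<in> words_on S"
  shows "pclass S R (x # w) = pclass S R [x] \<otimes>\<^bsub>presented_group S R\<^esub> pclass S R w"
  using presented_mult[of "[x]" S w R] assms by simp

lemma pclass_pw_Cons:
  assumes "g \<in> S" "set gs \<subseteq> S"
  shows "pclass S R (pw (g # gs)) = pgen S R g \<otimes>\<^bsub>presented_group S R\<^esub> pclass S R (pw gs)"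
proof -
  have "pclass S R ((g, True) # pw gs) = pgen S R g \<otimes>\<^bsub>presented_group S R\<^esub> pclass S R (pw gs)"
    unfolding pgen_def using assms by (intro pclass_Cons) auto
  then show ?thesis by (simp add: pw_def)
qed

lemma pclass_pw_single: "pclass S R (pw [g]) = pgen S R g"
  by (simp add: pw_def pgen_def)

section \<open>Evaluation of words and the universal property of a presentation\<close>

definition letter_eval :: "('b, 'm) monoid_scheme \<Rightarrow> ('g \<Rightarrow> 'b) \<Rightarrow> 'g \<times> bool \<Rightarrow> 'b" where
  "letter_eval K f x = (if snd x then f (fst x) else inv\<^bsub>K\<^esub> f (fst x))"

definition word_eval :: "('b, 'm) monoid_scheme \<Rightarrow> ('g \<Rightarrow> 'b) \<Rightarrow> 'g word \<Rightarrow> 'b" where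
  "word_eval K f w = foldr (\<lambda>x r. letter_eval K f x \<otimes>\<^bsub>K\<^esub> r) w \<one>\<^bsub>K\<^esub>"

lemma word_eval_Nil [simp]: "word_eval K f [] = \<one>\<^bsub>K\<^esub>"
  and word_eval_Cons [simp]:
    "word_eval K f (x # w) = letter_eval K f x \<otimes>\<^bsub>K\<^esub> word_eval K f w"
  by (simp_all add: word_eval_def)

text \<open>The chosen representative does not matter once evaluation is constant on classes, which
  \<open>word_eval_cong\<close> proves in \<open>presentation_map\<close>.\<close>

definition pres_lift :: "('b, 'm) monoid_scheme \<Rightarrow> ('g \<Rightarrow> 'b) \<Rightarrow> 'g word set \<Rightarrow> 'b" where
  "pres_lift K f X = word_eval K f (SOME w. w \<in> X)"

text \<open>The hypotheses of von Dyck's theorem: \<open>pres_lift_hom\<close> is the existence of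
  the induced homomorphism, \<open>presented_hom_eqI\<close> its uniqueness.\<close>

locale presentation_map = group K for K (structure) +
  fixes S :: "'g set" and R :: "('g word \<times> 'g word) set" and f :: "'g \<Rightarrow> 'a"
  assumes f_closed: "g \<in> S \<Longrightarrow> f g \<in> carrier K"
    and f_rel: "(l, r) \<in> R \<Longrightarrow> l \<in> words_on S \<Longrightarrow> r \<in> words_on S \<Longrightarrow>
      word_eval K f l = word_eval K f r"
begin

lemma letter_eval_closed: "fst x \<in> S \<Longrightarrow> letter_eval K f x \<in> carrier K"
  by (simp add: letter_eval_def f_closed)

lemma word_eval_closed [simp]: "w \<in> words_on S \<Longrightarrow> word_eval K f w \<in> carrier K"
  by (induction w) (auto simp: letter_eval_closed)

lemma word_eval_append:
  "u \<in> words_on S \<Longrightarrow> v \<in> words_on S \<Longrightarrow> word_eval K f (u @ v) = word_eval K f u \<otimes> word_eval K f v"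
  by (induction u) (auto simp: letter_eval_closed m_assoc)

lemma word_eval_cong: "pres_eq S R u v \<Longrightarrow> word_eval K f u = word_eval K f v"
proof (induction rule: pres_eq.induct)
  case (pe_cancel u v g b)
  have "letter_eval K f (g, b) \<otimes> (letter_eval K f (g, \<not> b) \<otimes> word_eval K f v) = word_eval K f v"
    using pe_cancel f_closed[of g] by (auto simp: letter_eval_def m_assoc[symmetric])
  then show ?case
    using pe_cancel by (simp add: word_eval_append)
next
  case (pe_rel u v l r)
  then show ?case by (simp add: word_eval_append f_rel)
qed auto

lemma pres_lift_pclass:
  assumes "w \<in> words_on S"
  shows "pres_lift K f (pclass S R w) = word_eval K f w"
proof -
  have "(SOME v. v \<in> pclass S R w) \<in> pclass S R w"
    using pclass_self[OF assms] by (rule someI)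
  then show ?thesis
    by (simp add: pres_lift_def pclass_def word_eval_cong)
qed

lemma pres_lift_pgen: "g \<in> S \<Longrightarrow> pres_lift K f (pgen S R g) = f g"
  by (simp add: pgen_def pres_lift_pclass letter_eval_def f_closed)

lemma pres_lift_hom: "pres_lift K f \<in> hom (presented_group S R) K"
  by (rule homI) (auto simp: presented_carrier pres_lift_pclass presented_mult word_eval_append)

end

lemma presented_hom_eqI:
  assumes K: "group K" and h: "h \<in> hom (presented_group S R) K" "k \<in> hom (presented_group S R) K"
    and gen: "\<And>g. g \<in> S \<Longrightarrow> h (pgen S R g) = k (pgen S R g)"
    and X: "X \<in> carrier (presented_group S R)"
  shows "h X = k X"
proof -
  let ?P = "presented_group S R"
  interpret h: group_hom ?P K h using K h by (simp add: group_hom_def group_hom_axioms_def)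
  interpret k: group_hom ?P K k using K h by (simp add: group_hom_def group_hom_axioms_def)
  have "h (pclass S R w) = k (pclass S R w)" if "w \<in> words_on S" for w
    using that
  proof (induction w)
    case Nil
    then show ?case
      using h.hom_one k.hom_one by (simp add: presented_one)
  next
    case (Cons x w)
    obtain g b where x: "x = (g, b)" by (cases x)
    have "h (pclass S R [x]) = k (pclass S R [x])"
    proof (cases b)
      case True
      then show ?thesis using gen[of g] Cons.prems x by (simp add: pgen_def)
    next
      case False
      then show ?thesis
        using gen[of g] Cons.prems x by (simp add: pclass_letter_False)
    qed
    moreover have "pclass S R (x # w) = pclass S R [x] \<otimes>\<^bsub>?P\<^esub> pclass S R w"
      using Cons.prems by (intro pclass_Cons) auto
    ultimately show ?case
      using Cons by simp
  qed
  then show ?thesis using X by (auto simp: presented_carrier)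
qed

section \<open>Semidirect products\<close>

lemma semidirect_simps:
  "carrier (semidirect G H act) = carrier G \<times> carrier H"
  "(g, h) \<otimes>\<^bsub>semidirect G H act\<^esub> (g', h') = (g \<otimes>\<^bsub>G\<^esub> act h g', h \<otimes>\<^bsub>H\<^esub> h')"
  "\<one>\<^bsub>semidirect G H act\<^esub> = (\<one>\<^bsub>G\<^esub>, \<one>\<^bsub>H\<^esub>)"
  by (simp_all add: semidirect_def)

lemma group_semidirect:
  assumes G: "group G" and H: "group H"
    and hom: "\<And>h. h \<in> carrier H \<Longrightarrow> act h \<in> hom G G"
    and one: "\<And>g. g \<in> carrier G \<Longrightarrow> act \<one>\<^bsub>H\<^esub> g = g"
    and mult: "\<And>h k g. h \<in> carrier H \<Longrightarrow> k \<in> carrier H \<Longrightarrow> g \<in> carrier G \<Longrightarrow>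
      act (h \<otimes>\<^bsub>H\<^esub> k) g = act h (act k g)"
  shows "group (semidirect G H act)"
proof -
  interpret G: group G by fact
  interpret H: group H by fact
  have closed [simp]: "act h g \<in> carrier G" if "h \<in> carrier H" "g \<in> carrier G" for h g
    using hom that by (auto simp: hom_def)
  have act_mult [simp]: "act h (g \<otimes>\<^bsub>G\<^esub> g') = act h g \<otimes>\<^bsub>G\<^esub> act h g'"
    if "h \<in> carrier H" "g \<in> carrier G" "g' \<in> carrier G" for h g g'
    using hom[OF that(1)] that by (auto simp: hom_def)
  show ?thesis
  proof (rule groupI)
    fix x
    assume "x \<in> carrier (semidirect G H act)"
    then obtain g h where x: "x = (g, h)" "g \<in> carrier G" "h \<in> carrier H"
      by (auto simp: semidirect_simps)
    let ?k = "inv\<^bsub>H\<^esub> h"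
    have "(act ?k (inv\<^bsub>G\<^esub> g), ?k) \<otimes>\<^bsub>semidirect G H act\<^esub> x = \<one>\<^bsub>semidirect G H act\<^esub>"
    proof -
      interpret a: group_hom G G "act ?k"
        using x hom[of ?k] G by (simp add: group_hom_def group_hom_axioms_def)
      show ?thesis
        using x by (simp add: semidirect_simps flip: act_mult)
    qed
    then show "\<exists>y\<in>carrier (semidirect G H act). y \<otimes>\<^bsub>semidirect G H act\<^esub> x = \<one>\<^bsub>semidirect G H act\<^esub>"
      using x by (intro bexI[of _ "(act ?k (inv\<^bsub>G\<^esub> g), ?k)"]) (auto simp: semidirect_simps)
  qed (auto simp: semidirect_simps one mult G.m_assoc H.m_assoc)
qed

section \<open>The root system\<close>

text \<open>Coordinates for roots. Every root has two such descriptions, exchanged by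
  \<open>rt_commute\<close>; many later steps only reorder the two summands.\<close>

definition rt :: "int \<Rightarrow> nat \<Rightarrow> int \<Rightarrow> nat \<Rightarrow> vec" where
  "rt s i t j = vadd (vsmult s (eps i)) (vsmult t (eps j))"

lemma rt_apply: "rt s i t j k = s * (if k = i then 1 else 0) + t * (if k = j then 1 else 0)"
  by (simp add: rt_def vadd_def vsmult_def eps_def)

lemma rt_commute: "rt s i t j = rt t j s i"
  by (simp add: rt_apply fun_eq_iff)

lemma alpha_eq_rt: "alpha i = rt (-1) (i - 1) 1 i"
  by (simp add: alpha_def rt_def vadd_def vsmult_def)

lemma alpha2'_eq_rt: "alpha2' = rt 1 1 1 2"
  by (simp add: alpha2'_def rt_def vadd_def vsmult_def)

lemma ip_commute: "ip n u v = ip n v u"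
  by (simp add: ip_def mult.commute)

lemma ip_vadd_left: "ip n (vadd u v) w = ip n u w + ip n v w"
  by (simp add: ip_def vadd_def distrib_right sum.distrib)

lemma ip_vadd_right: "ip n w (vadd u v) = ip n w u + ip n w v"
  by (simp add: ip_commute[of n w] ip_vadd_left)

lemma refl_apply: "refl n a v k = v k - ip n v a * a k"
  by (simp add: refl_def)

lemma ip_refl_left: "ip n (refl n a v) w = ip n v w - ip n v a * ip n a w"
proof -
  have "ip n (refl n a v) w = (\<Sum>k\<in>{1..n}. v k * w k - ip n v a * (a k * w k))"
    by (simp add: ip_def[of n "refl n a v"] refl_apply left_diff_distrib mult.assoc)
  then show ?thesis
    by (simp add: sum_subtractf ip_def[of n v w] ip_def[of n a w] sum_distrib_left)
qed

lemma ip_refl_right: "ip n w (refl n a v) = ip n w v - ip n v a * ip n w a"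
  by (simp add: ip_commute[of n w] ip_refl_left)

lemma ip_rt:
  assumes "i \<in> {1..n}" "j \<in> {1..n}"
  shows "ip n v (rt s i t j) = s * v i + t * v j"
proof -
  have "ip n v (rt s i t j) = (\<Sum>k\<in>{1..n}. (if k = i then s * v k else 0) + (if k = j then t * v k else 0))"
    unfolding ip_def by (intro sum.cong) (auto simp: rt_apply algebra_simps)
  then show ?thesis
    using assms by (simp add: sum.distrib)
qed

lemma refl_vadd: "refl n a (vadd u v) = vadd (refl n a u) (refl n a v)"
  by (rule ext) (simp add: refl_def vadd_def ip_vadd_left[unfolded vadd_def] algebra_simps)

text \<open>Norm 2 makes \<open>refl n a\<close> an isometry, so it carries the reflection in
  \<open>b\<close> to the reflection in the image of \<open>b\<close>.\<close>

lemma refl_conj: "ip n a a = 2 \<Longrightarrow> refl n a (refl n b v) = refl n (refl n a b) (refl n a v)"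
  by (rule ext) (simp add: refl_apply ip_refl_left ip_refl_right ip_commute[of n b a] algebra_simps)

lemma refl_refl: "ip n a a = 2 \<Longrightarrow> refl n a (refl n a v) = v"
  by (rule ext) (simp add: refl_apply ip_refl_left)

lemma refl_orthogonal: "ip n v a = 0 \<Longrightarrow> refl n a v = v"
  by (simp add: refl_def)

lemma refl_self: "ip n a a = 2 \<Longrightarrow> refl n a a = vsmult (-1) a"
  by (simp add: refl_def vsmult_def fun_eq_iff)

lemma refl_vsmult: "refl n a (vsmult c v) = vsmult c (refl n a v)"
  by (simp add: refl_def vsmult_def fun_eq_iff ip_def sum_distrib_left algebra_simps)

lemma ip_vsmult_left: "ip n (vsmult c v) w = c * ip n v w"
  by (simp add: vsmult_def ip_def sum_distrib_left algebra_simps)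

lemma ip_vsmult_right: "ip n w (vsmult c v) = c * ip n w v"
  by (simp add: ip_commute[of n w] ip_vsmult_left)

lemma refl_eq_vadd: "ip n v a = -1 \<Longrightarrow> refl n a v = vadd v a"
  by (simp add: refl_def vadd_def fun_eq_iff)

text \<open>Both \<open>refl n a b\<close> and \<open>refl n b a\<close> equal \<open>a + b\<close>,
  so by \<open>refl_conj\<close> each side is the reflection in this one vector.\<close>

lemma refl_braid:
  assumes "ip n a a = 2" "ip n b b = 2" "ip n a b = -1"
  shows "refl n a (refl n b (refl n a v)) = refl n b (refl n a (refl n b v))"
proof -
  have "refl n a b = refl n b a"
    using assms ip_commute[of n a b] by (simp add: refl_eq_vadd vadd_def fun_eq_iff)
  then have "refl n a (refl n b (refl n a v)) = refl n (refl n b a) v"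
    using assms refl_conj[of n a b "refl n a v"] by (simp add: refl_refl)
  then show ?thesis
    using assms refl_conj[of n b a "refl n b v"] by (simp add: refl_refl)
qed

lemma rt_in_Dn:
  "i \<in> {1..n} \<Longrightarrow> j \<in> {1..n} \<Longrightarrow> i \<noteq> j \<Longrightarrow> s \<in> {1, -1} \<Longrightarrow> t \<in> {1, -1} \<Longrightarrow> rt s i t j \<in> Dn n"
  unfolding Dn_def rt_def by fastforce

text \<open>A sum of integer squares equal to 2 has exactly two non-zero terms, both 1. In this
  form, closure under reflections and the question whether a sum is a root become computations of
  norms.\<close>

lemma Dn_iff: "v \<in> Dn n \<longleftrightarrow> (\<forall>k. k \<notin> {1..n} \<longrightarrow> v k = 0) \<and> ip n v v = 2"
proof
  assume "v \<in> Dn n"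
  then obtain i j s t where v: "v = rt s i t j" "i \<in> {1..n}" "j \<in> {1..n}" "i \<noteq> j"
    and st: "s \<in> {1, -1}" "t \<in> {1, -1}"
    by (auto simp: Dn_def rt_def)
  have "ip n v v = 2"
    unfolding v(1) using v st by (subst ip_rt) (auto simp: rt_apply)
  then show "(\<forall>k. k \<notin> {1..n} \<longrightarrow> v k = 0) \<and> ip n v v = 2"
    using v by (auto simp: rt_apply)
next
  have unit: "x = 1 \<or> x = -1" if "x * x \<le> 2" "x \<noteq> 0" for x :: int
  proof (rule ccontr)
    assume "\<not> ?thesis"
    then have "\<bar>x\<bar> \<ge> 2" using that by linarith
    then have "\<bar>x\<bar> * \<bar>x\<bar> \<ge> 2 * 2" by (intro mult_mono) auto
    then show False using that by simp
  qed
  assume v: "(\<forall>k. k \<notin> {1..n} \<longrightarrow> v k = 0) \<and> ip n v v = 2"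
  \<comment> \<open>Peels off one coordinate of absolute value 1; used with \<open>m = 1\<close> and
    again with \<open>m = 0\<close>. The bound \<open>m \<le> 1\<close> keeps each square at most 2,
    as \<open>unit\<close> requires.\<close>
  have step: "\<exists>i\<in>I. (v i = 1 \<or> v i = -1) \<and> (\<Sum>k\<in>I - {i}. v k * v k) = m"
    if "finite I" "(\<Sum>k\<in>I. v k * v k) = m + 1" "0 \<le> m" "m \<le> 1" for I m
  proof -
    have "\<exists>i\<in>I. v i \<noteq> 0"
    proof (rule ccontr)
      assume "\<not> ?thesis"
      then have "(\<Sum>k\<in>I. v k * v k) = 0" by (intro sum.neutral) auto
      then show False using that by simp
    qed
    then obtain i where i: "i \<in> I" "v i \<noteq> 0" by blast
    have split: "m + 1 = v i * v i + (\<Sum>k\<in>I - {i}. v k * v k)"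
      using that i by (simp add: sum.remove)
    have "(\<Sum>k\<in>I - {i}. v k * v k) \<ge> 0"
      by (intro sum_nonneg) simp
    then have "v i = 1 \<or> v i = -1"
      using split that i by (intro unit) auto
    then show ?thesis using split i by auto
  qed
  have "(\<Sum>k\<in>{1..n}. v k * v k) = 1 + 1"
    using v unfolding ip_def by linarith
  from step[OF finite_atLeastAtMost this] obtain i
    where i: "i \<in> {1..n}" "v i = 1 \<or> v i = -1" and si: "(\<Sum>k\<in>{1..n} - {i}. v k * v k) = 0 + 1"
    unfolding add_0 using zero_le_one order_refl by blast
  from step[OF finite_Diff[OF finite_atLeastAtMost] si] obtain j
    where j: "j \<in> {1..n} - {i}" "v j = 1 \<or> v j = -1" and sj: "(\<Sum>k\<in>{1..n} - {i} - {j}. v k * v k) = 0"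
    using zero_le_one order_refl by blast
  have "\<forall>k\<in>{1..n} - {i} - {j}. v k * v k = 0"
    using sj sum_nonneg_eq_0_iff[of "{1..n} - {i} - {j}" "\<lambda>k. v k * v k"] by simp
  then have zero: "v k = 0" if "k \<noteq> i" "k \<noteq> j" for k
    using v that by (cases "k \<in> {1..n}") auto
  have eq: "v = rt (v i) i (v j) j"
  proof
    fix k
    show "v k = rt (v i) i (v j) j k"
      using zero[of k] j by (auto simp: rt_apply)
  qed
  have "rt (v i) i (v j) j \<in> Dn n"
    using i j by (intro rt_in_Dn) auto
  then show "v \<in> Dn n"
    unfolding eq[symmetric] .
qed

lemma Dn_ip_self: "v \<in> Dn n \<Longrightarrow> ip n v v = 2"
  by (simp add: Dn_iff)

lemma Dn_cases:
  assumes "v \<in> Dn n"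
  obtains s i t j where "v = rt s i t j" "i \<in> {1..n}" "j \<in> {1..n}" "i < j" "s \<in> {1, -1}" "t \<in> {1, -1}"
proof -
  obtain i j s t where v: "v = rt s i t j" "i \<in> {1..n}" "j \<in> {1..n}" "i \<noteq> j" "s \<in> {1, -1}" "t \<in> {1, -1}"
    using assms unfolding Dn_def rt_def by fastforce
  show thesis
  proof (cases "i < j")
    case True
    then show thesis using v that by blast
  next
    case False
    then show thesis using v that[of t j s i] by (simp add: rt_commute)
  qed
qed

lemma refl_Dn: "a \<in> Dn n \<Longrightarrow> v \<in> Dn n \<Longrightarrow> refl n a v \<in> Dn n"
  unfolding Dn_iff by (simp add: ip_refl_left ip_refl_right ip_commute[of n a v]) (simp add: refl_def)

lemma refl_Dn_iff: "a \<in> Dn n \<Longrightarrow> refl n a v \<in> Dn n \<longleftrightarrow> v \<in> Dn n"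
  using refl_Dn[of a n v] refl_Dn[of a n "refl n a v"] refl_refl[of n a v] Dn_ip_self by fastforce

lemma vsmult_minus_Dn: "v \<in> Dn n \<Longrightarrow> vsmult (-1) v \<in> Dn n"
  by (simp add: Dn_iff vsmult_def ip_def)

text \<open>The equality case of Cauchy-Schwarz: the squared norm of \<open>u + c v\<close> is 2 - 4
  + 2 = 0, and the form is positive definite on vectors supported in \<open>{1..n}\<close>.\<close>

lemma Dn_norm_zero:
  assumes "u \<in> Dn n" "v \<in> Dn n" "\<bar>c\<bar> = 1" "ip n u v = - 2 * c"
  shows "vadd u (vsmult c v) = vzero"
proof -
  let ?d = "vadd u (vsmult c v)"
  have "c * c = 1" using assms(3) by (metis abs_mult_self_eq mult_1)
  then have "ip n ?d ?d = 0"
    using assms by (simp add: ip_vadd_left ip_vadd_right ip_vsmult_left ip_vsmult_right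
        ip_commute[of n v u] Dn_ip_self algebra_simps)
  then have "\<forall>k\<in>{1..n}. ?d k * ?d k = 0"
    unfolding ip_def by (subst (asm) sum_nonneg_eq_0_iff) auto
  moreover have "\<forall>k. k \<notin> {1..n} \<longrightarrow> ?d k = 0"
    using assms by (simp add: Dn_iff vadd_def vsmult_def)
  ultimately show ?thesis
    by (auto simp: vzero_def fun_eq_iff)
qed

lemma Dn_ip_2: "u \<in> Dn n \<Longrightarrow> v \<in> Dn n \<Longrightarrow> ip n u v = 2 \<Longrightarrow> u = v"
  using Dn_norm_zero[of u n v "-1"] by (auto simp: vadd_def vsmult_def vzero_def fun_eq_iff)

lemma Dn_vadd_eq_zero_iff:
  assumes "u \<in> Dn n" "v \<in> Dn n"
  shows "vadd u v = vzero \<longleftrightarrow> ip n u v = -2"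
proof
  assume "vadd u v = vzero"
  then have "u = vsmult (-1) v"
    by (auto simp: vadd_def vsmult_def vzero_def fun_eq_iff add_eq_0_iff)
  then show "ip n u v = -2"
    using assms by (simp add: ip_vsmult_left Dn_ip_self)
qed (use Dn_norm_zero[of u n v 1] assms in \<open>auto simp: vsmult_def\<close>)

lemma Dn_ip_m2: "u \<in> Dn n \<Longrightarrow> v \<in> Dn n \<Longrightarrow> ip n u v = -2 \<Longrightarrow> u = vsmult (-1) v"
  using Dn_vadd_eq_zero_iff[of u n v] by (auto simp: vadd_def vsmult_def vzero_def fun_eq_iff add_eq_0_iff)

lemma Dn_vadd_iff: "u \<in> Dn n \<Longrightarrow> v \<in> Dn n \<Longrightarrow> vadd u v \<in> Dn n \<longleftrightarrow> ip n u v = -1"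
  unfolding Dn_iff by (auto simp: ip_vadd_left ip_vadd_right ip_commute[of n v u]) (simp_all add: vadd_def)

text \<open>The squared norms of \<open>u + v\<close> and \<open>u - v\<close> are 4 plus and 4
  minus twice the inner product, and neither is negative.\<close>

lemma Dn_ip_range:
  assumes "u \<in> Dn n" "v \<in> Dn n"
  shows "ip n u v \<in> {-2, -1, 0, 1, 2}"
proof -
  have "0 \<le> ip n w w" for w
    unfolding ip_def by (intro sum_nonneg) simp
  from this[of "vadd u v"] this[of "vadd u (vsmult (-1) v)"] show ?thesis
    using assms by (auto simp: ip_vadd_left ip_vadd_right ip_vsmult_left ip_vsmult_right
        ip_commute[of n v u] Dn_ip_self)
qed

text \<open>The vector \<open>(0, 1, ..., n-1)\<close> is half the sum of the positive roots. It
  pairs to 1 with every simple root, so this is the usual height.\<close>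

definition ht :: "nat \<Rightarrow> vec \<Rightarrow> int" where
  "ht n v = ip n v (\<lambda>k. int k - 1)"

lemma ht_refl: "ht n (refl n a v) = ht n v - ip n v a * ht n a"
  by (simp add: ht_def ip_refl_left)

lemma ht_vsmult: "ht n (vsmult c v) = c * ht n v"
  by (simp add: ht_def ip_vsmult_left)

lemma ht_rt: "i \<in> {1..n} \<Longrightarrow> j \<in> {1..n} \<Longrightarrow> ht n (rt s i t j) = s * (int i - 1) + t * (int j - 1)"
  by (simp add: ht_def ip_commute[of n "rt s i t j"] ip_rt)

lemma ip_alpha: "i \<in> {2..n} \<Longrightarrow> ip n v (alpha i) = v i - v (i - 1)"
  by (subst alpha_eq_rt, subst ip_rt) auto

lemma ip_alpha2': "2 \<le> n \<Longrightarrow> ip n v alpha2' = v 1 + v 2"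
  by (subst alpha2'_eq_rt, subst ip_rt) auto

lemma alpha_apply: "1 \<le> i \<Longrightarrow> alpha i k = (if k = i then 1 else if k = i - 1 then -1 else 0)"
  by (auto simp: alpha_eq_rt rt_apply)

lemma alpha2'_apply: "alpha2' k = (if k = 1 \<or> k = 2 then 1 else 0)"
  by (auto simp: alpha2'_eq_rt rt_apply)

lemma alpha_eq_iff: "1 \<le> i \<Longrightarrow> 1 \<le> j \<Longrightarrow> alpha i = alpha j \<longleftrightarrow> i = j"
proof
  assume "1 \<le> i" "1 \<le> j" "alpha i = alpha j"
  from fun_cong[OF this(3), of i] this(1,2) show "i = j"
    by (simp add: alpha_apply split: if_splits)
qed simp

lemma alpha_neq_alpha2': "1 \<le> i \<Longrightarrow> alpha i \<noteq> alpha2'"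
proof
  assume "1 \<le> i" "alpha i = alpha2'"
  from fun_cong[OF this(2), of 1] fun_cong[OF this(2), of 2] show False
    using \<open>1 \<le> i\<close> by (auto simp: alpha_apply alpha2'_apply split: if_splits)
qed

lemma adj_lt_iff:
  assumes "3 \<le> n"
  shows "i \<in> {2..n} \<Longrightarrow> j \<in> {2..n} \<Longrightarrow> adj_lt n (alpha i) (alpha j) \<longleftrightarrow> j = Suc i"
    and "j \<in> {2..n} \<Longrightarrow> adj_lt n alpha2' (alpha j) \<longleftrightarrow> j = 3"
    and "i \<in> {2..n} \<Longrightarrow> \<not> adj_lt n (alpha i) alpha2'"
    and "\<not> adj_lt n alpha2' alpha2'"
  using assms by (auto simp: adj_lt_def alpha_eq_iff alpha_neq_alpha2' alpha_neq_alpha2'[symmetric])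

lemma Delta_cases:
  assumes "a \<in> Delta n"
  obtains "a = alpha2'" | i where "i \<in> {2..n}" "a = alpha i"
  using assms by (auto simp: Delta_def)

lemma Delta_Dn: "3 \<le> n \<Longrightarrow> a \<in> Delta n \<Longrightarrow> a \<in> Dn n"
  by (erule Delta_cases) (auto simp: alpha_eq_rt alpha2'_eq_rt intro!: rt_in_Dn)

lemma ht_Delta: "3 \<le> n \<Longrightarrow> a \<in> Delta n \<Longrightarrow> ht n a = 1"
  unfolding ht_def ip_commute[of n a] by (erule Delta_cases) (auto simp: ip_alpha ip_alpha2')

text \<open>Trades adjacency in the Dynkin diagram for inner products, which reflections preserve
  and which can be computed for all roots.\<close>

lemma ip_Delta:
  assumes "3 \<le> n" "a \<in> Delta n" "b \<in> Delta n" "a \<noteq> b"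
  shows "ip n a b = (if adjacent n a b then -1 else 0)"
  using assms(2,3)
proof (elim Delta_cases)
  fix i j assume "i \<in> {2..n}" "j \<in> {2..n}" "a = alpha i" "b = alpha j"
  then show ?thesis
    using assms by (auto simp: adjacent_def adj_lt_iff ip_alpha alpha_apply)
qed (use assms in \<open>auto simp: adjacent_def adj_lt_iff ip_alpha ip_alpha2' alpha_apply alpha2'_apply\<close>)

text \<open>The height is \<open>s * (i - 1) + t * (j - 1)\<close>; as \<open>i < j\<close>, the
  second term dominates and \<open>t\<close> decides the sign.\<close>

lemma positive_cases:
  assumes "v \<in> Dn n" "0 < ht n v"
  obtains s i j where "v = rt s i 1 j" "1 \<le> i" "i < j" "j \<le> n" "s \<in> {1, -1}"
proof -
  obtain s i t j where v: "v = rt s i t j" "i \<in> {1..n}" "j \<in> {1..n}" "i < j" "s \<in> {1, -1}" "t \<in> {1, -1}"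
    using assms by (elim Dn_cases)
  then have "t = 1" using assms by (auto simp: ht_rt)
  then show thesis using v that by auto
qed

lemma ht_nonzero: "v \<in> Dn n \<Longrightarrow> ht n v \<noteq> 0"
  by (elim Dn_cases) (auto simp: ht_rt)

lemma ht_1_Delta:
  assumes "v \<in> Dn n" "ht n v = 1"
  shows "v \<in> Delta n"
proof -
  obtain s i j where v: "v = rt s i 1 j" "1 \<le> i" "i < j" "j \<le> n" "s \<in> {1, -1}"
    using assms by (auto elim: positive_cases)
  show ?thesis
  proof (cases "s = 1")
    case True
    then have "i = 1" "j = 2" using v assms by (auto simp: ht_rt)
    then have "v = alpha2'" using v(1) True by (simp only: alpha2'_eq_rt)
    then show ?thesis by (simp add: Delta_def)
  next
    case False
    then have "s = -1" "i = j - 1" using v assms by (auto simp: ht_rt)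
    then have "v = alpha j" using v(1) by (simp only: alpha_eq_rt)
    then show ?thesis using v by (auto simp: Delta_def)
  qed
qed

lemma positive_root_descent:
  assumes "v \<in> Dn n" "1 < ht n v"
  shows "\<exists>d\<in>Delta n. ip n v d = 1"
proof -
  obtain s i j where v: "v = rt s i 1 j" "1 \<le> i" "i < j" "j \<le> n" "s \<in> {1, -1}"
    using assms by (auto elim: positive_cases)
  show ?thesis
  \<comment> \<open>\<open>alpha j\<close> lowers the root unless coordinate \<open>j - 1\<close> is
    occupied too. In that case height above 1 leaves only \<open>eps i + eps j\<close> with
    \<open>2 \<le> i\<close>, which \<open>alpha i\<close> lowers.\<close>
  proof (cases "i = j - 1")
    case False
    then show ?thesis
      using v by (intro bexI[of _ "alpha j"]) (auto simp: ip_alpha rt_apply Delta_def)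
  next
    case True
    then have "s = 1" "2 \<le> i" using v assms by (auto simp: ht_rt)
    then show ?thesis
      using v by (intro bexI[of _ "alpha i"]) (auto simp: ip_alpha rt_apply Delta_def)
  qed
qed

section \<open>Extending a family from the simple roots to all roots\<close>

text \<open>The operators satisfy the braid relations on the whole type, but they are not assumed to
  be involutions and so need not define an action of the Weyl group.\<close>

locale braid_action =
  fixes n :: nat and s :: "vec \<Rightarrow> 'w \<Rightarrow> 'w"
  assumes n_ge_3: "3 \<le> n"
    and s_commute: "\<lbrakk>a \<in> Delta n; b \<in> Delta n; ip n a b = 0\<rbrakk> \<Longrightarrow> s a (s b g) = s b (s a g)"
    and s_braid: "\<lbrakk>a \<in> Delta n; b \<in> Delta n; ip n a b = -1\<rbrakk> \<Longrightarrow>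
      s a (s b (s a g)) = s b (s a (s b g))"

text \<open>\<open>x b\<close> is the value at the simple root \<open>b\<close>, and
  \<open>s a (x b)\<close> is meant to be the value at \<open>refl n a b\<close>. The prospective
  value \<open>s a (x a)\<close> at \<open>-a\<close> is left open, so that the locale can serve
  once for the positive and once for the negative roots.\<close>

locale positive_family = braid_action n s for n and s :: "vec \<Rightarrow> 'w \<Rightarrow> 'w" +
  fixes x :: "vec \<Rightarrow> 'w"
  assumes x_orthogonal: "\<lbrakk>a \<in> Delta n; b \<in> Delta n; ip n a b = 0\<rbrakk> \<Longrightarrow> s a (x b) = x b"
    and x_swap: "\<lbrakk>a \<in> Delta n; b \<in> Delta n; ip n a b = -1\<rbrakk> \<Longrightarrow> s a (x b) = s b (x a)"
    and x_square: "\<lbrakk>a \<in> Delta n; b \<in> Delta n; ip n a b = -1\<rbrakk> \<Longrightarrow> s a (s a (x b)) = x b"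
begin

text \<open>The counter is the height minus one. Each step takes an arbitrary simple root that
  lowers \<open>v\<close>; \<open>X_positive\<close> shows that the choice does not affect the
  value.\<close>

primrec ext :: "nat \<Rightarrow> vec \<Rightarrow> 'w" where
  "ext 0 v = x v"
| "ext (Suc h) v = (let d = SOME d. d \<in> Delta n \<and> ip n v d = 1 in s d (ext h (refl n d v)))"

definition X :: "vec \<Rightarrow> 'w" where
  "X v = ext (nat (ht n v - 1)) v"

lemma X_simple: "a \<in> Delta n \<Longrightarrow> X a = x a"
  by (simp add: X_def ht_Delta n_ge_3)

lemma X_descent:
  assumes "v \<in> Dn n" "1 < ht n v"
  obtains d where "d \<in> Delta n" "ip n v d = 1" "X v = s d (X (refl n d v))"
proof -
  define d where "d = (SOME d. d \<in> Delta n \<and> ip n v d = 1)"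
  have d: "d \<in> Delta n \<and> ip n v d = 1"
    unfolding d_def using positive_root_descent[OF assms] by (intro someI_ex[of "\<lambda>d. d \<in> Delta n \<and> ip n v d = 1"]) blast
  then have "nat (ht n v - 1) = Suc (nat (ht n (refl n d v) - 1))"
    using assms by (simp add: ht_refl ht_Delta n_ge_3)
  then have "X v = s d (X (refl n d v))"
    by (simp add: X_def d_def Let_def)
  then show thesis using d that by blast
qed

text \<open>The clauses (any descent gives the same value, orthogonal simple roots fix it, squares
  of ascending steps are trivial) feed on one another at lower heights, hence the joint induction.
  The chosen descent \<open>d\<close> is compared with an arbitrary \<open>b\<close> inside the rank
  two system they span, of type A1 x A1 or A2.\<close>

lemma X_positive:
  assumes "v \<in> Dn n" "0 < ht n v"
  shows "\<forall>b\<in>Delta n. (ip n v b = 1 \<longrightarrow> X v = s b (X (refl n b v))) \<and>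
    (ip n v b = 0 \<longrightarrow> s b (X v) = X v) \<and> (ip n v b = -1 \<longrightarrow> s b (s b (X v)) = X v)"
  using assms
proof (induction "nat (ht n v)" arbitrary: v rule: less_induct)
  case less
  show ?case
  proof (cases "ht n v = 1")
    case True
    then have v: "v \<in> Delta n" using less.prems by (simp add: ht_1_Delta)
    have two: "ip n v v = 2" using less.prems by (simp add: Dn_ip_self)
    show ?thesis
    proof (intro ballI conjI impI)
      fix b assume b: "b \<in> Delta n"
      \<comment> \<open>Vacuous: two simple roots never have inner product 1.\<close>
      show "X v = s b (X (refl n b v))" if "ip n v b = 1"
        using that two ip_Delta[OF n_ge_3 v b] by (cases "v = b") (auto split: if_splits)
      show "s b (X v) = X v" if "ip n v b = 0"
        using that v b by (simp add: X_simple x_orthogonal ip_commute)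
      show "s b (s b (X v)) = X v" if "ip n v b = -1"
        using that v b by (simp add: X_simple x_square ip_commute)
    qed
  next
    case False
    then have ht: "1 < ht n v" using less.prems by simp
    then obtain d where d: "d \<in> Delta n" "ip n v d = 1" "X v = s d (X (refl n d v))"
      using less.prems X_descent by blast
    let ?w = "refl n d v"
    have D [simp]: "d \<in> Dn n" "ip n d d = 2"
      using d n_ge_3 by (auto simp: Delta_Dn Dn_ip_self)
    have w: "?w \<in> Dn n" "ht n ?w = ht n v - 1" "ip n ?w d = -1"
      using less.prems d n_ge_3 by (auto simp: refl_Dn ht_refl ht_Delta ip_refl_left)
    have wpos: "0 < ht n ?w" "nat (ht n ?w) < nat (ht n v)"
      using w ht by auto
    note IHw = less.hyps[OF wpos(2) w(1) wpos(1), rule_format]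
    show ?thesis
    proof
      fix b assume b: "b \<in> Delta n"
      have B [simp]: "b \<in> Dn n" "ip n b b = 2"
        using b n_ge_3 by (auto simp: Delta_Dn Dn_ip_self)
      show "(ip n v b = 1 \<longrightarrow> X v = s b (X (refl n b v))) \<and>
        (ip n v b = 0 \<longrightarrow> s b (X v) = X v) \<and> (ip n v b = -1 \<longrightarrow> s b (s b (X v)) = X v)"
      proof (cases "b = d")
        case True
        then show ?thesis using d by simp
      next
        case False
        have bd: "ip n b d = ip n d b" by (rule ip_commute)
        have wb: "ip n ?w b = ip n v b - ip n d b"
          using d by (simp add: ip_refl_left)
        \<comment> \<open>the second descent step, when it exists, stays among the positive roots\<close>
        have u: "refl n b ?w \<in> Dn n" "0 < ht n (refl n b ?w)" "nat (ht n (refl n b ?w)) < nat (ht n v)"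
          if "ip n ?w b = 1"
        proof -
          show "refl n b ?w \<in> Dn n" using w by (simp add: refl_Dn)
          moreover have "ht n (refl n b ?w) = ht n v - 2"
            using that w b n_ge_3 by (simp add: ht_refl[of n b] ht_Delta)
          ultimately show "0 < ht n (refl n b ?w)" "nat (ht n (refl n b ?w)) < nat (ht n v)"
            using ht_nonzero[of "refl n b ?w" n] ht by auto
        qed
        consider "ip n d b = 0" | "ip n d b = -1"
          using ip_Delta[OF n_ge_3 d(1) b] False by (auto split: if_splits)
        then show ?thesis
        proof cases
          case 1
          have cm: "s b (s d g) = s d (s b g)" for g
            using s_commute[OF b d(1)] bd 1 by simp
          \<comment> \<open>Type A1 x A1: the descents by \<open>b\<close> and by \<open>d\<close>
            meet again one step lower, at \<open>refl n b ?w\<close>.\<close>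
          have "X v = s b (X (refl n b v))" if vb: "ip n v b = 1"
          proof -
            let ?t = "refl n b v"
            have t: "?t \<in> Dn n" "ht n ?t = ht n v - 1" "ip n ?t d = 1"
              using less.prems b vb n_ge_3 d 1 bd by (auto simp: refl_Dn ht_refl ht_Delta ip_refl_left)
            then have tpos: "0 < ht n ?t" "nat (ht n ?t) < nat (ht n v)"
              using ht by auto
            have "X ?t = s d (X (refl n d ?t))"
              using less.hyps[OF tpos(2) t(1) tpos(1)] d(1) t(3) by blast
            moreover have "refl n d ?t = refl n b ?w"
              using refl_conj[of n d b v] 1 bd by (simp add: refl_orthogonal)
            moreover have "X ?w = s b (X (refl n b ?w))"
              using IHw[OF b] wb vb 1 by simp
            ultimately show ?thesis
              using d(3) cm by simp
          qed
          moreover have "s b (X v) = X v" if "ip n v b = 0"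
            using that IHw[OF b] wb 1 d(3) cm by simp
          moreover have "s b (s b (X v)) = X v" if "ip n v b = -1"
            using that IHw[OF b] wb 1 d(3) cm by simp
          ultimately show ?thesis by blast
        next
          case 2
          have br: "s b (s d (s b g)) = s d (s b (s d g))" for g
            using s_braid[OF b d(1)] bd 2 by simp
          have "X v = s b (X (refl n b v))" if vb: "ip n v b = 1"
          proof -
            \<comment> \<open>The pairing of \<open>?w\<close> with \<open>b\<close> is 2, hence
              \<open>v = b + d\<close>. The two descents end at the simple roots \<open>b\<close>
              and \<open>d\<close>, and \<open>x_swap\<close> is their agreement.\<close>
            have "?w = b" using Dn_ip_2[OF w(1) B(1)] wb vb 2 by simp
            moreover have "refl n b v = d"
              using less.prems vb 2 d bd by (intro Dn_ip_2[of _ n]) (auto simp: refl_Dn ip_refl_left)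
            ultimately show ?thesis
              using d b x_swap[OF d(1) b 2] by (simp add: X_simple)
          qed
          moreover have "s b (X v) = X v" if vb: "ip n v b = 0"
          proof -
            \<comment> \<open>Here \<open>X v = s d (s b (X ?u))\<close> with \<open>?u\<close>
              orthogonal to \<open>d\<close>. The braid relation turns an outer \<open>s b\<close>
              into an inner \<open>s d\<close>, which fixes \<open>X ?u\<close>.\<close>
            have wb1: "ip n ?w b = 1" using wb vb 2 by simp
            let ?u = "refl n b ?w"
            have "ip n ?u d = 0"
              using wb1 w bd 2 by (simp add: ip_refl_left[of n b])
            then have "s d (X ?u) = X ?u"
              using less.hyps[OF u(3)[OF wb1] u(1,2)[OF wb1]] d(1) by blast
            moreover have "X ?w = s b (X ?u)"
              using IHw[OF b] wb1 by simp
            ultimately show ?thesis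
              using d(3) br by simp
          qed
          moreover have "s b (s b (X v)) = X v" if "ip n v b = -1"
          proof -
            \<comment> \<open>Since \<open>s b\<close> fixes \<open>X ?w\<close>, an extra
              \<open>s b\<close> may be inserted innermost. Two braid moves then turn the square of
              \<open>s b\<close> on the outside into the square of \<open>s d\<close> on the
              inside.\<close>
            have "s b (X ?w) = X ?w" using IHw[OF b] wb that 2 by simp
            moreover have "s d (s d (X ?w)) = X ?w" using IHw[OF d(1)] w by simp
            moreover have "s b (s b (s d (s b g))) = s d (s b (s d (s d g)))" for g
              by (simp add: br)
            ultimately show ?thesis
              using d(3) by metis
          qed
          ultimately show ?thesis by blast
        qed
      qed
    qed
  qed
qed

text \<open>A simple reflection makes no positive root negative except its own. Pairing 2 is
  excluded by \<open>v \<noteq> b\<close> and pairing -2 by positivity, so the clauses of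
  \<open>X_positive\<close> at \<open>v\<close> and at its image cover all cases.\<close>

lemma X_step:
  assumes v: "v \<in> Dn n" "0 < ht n v" and b: "b \<in> Delta n" and "v \<noteq> b"
  shows "s b (X v) = X (refl n b v)" "0 < ht n (refl n b v)"
proof -
  have B: "b \<in> Dn n" "ip n b b = 2"
    using b n_ge_3 by (auto simp: Delta_Dn Dn_ip_self)
  note P = X_positive[OF v, rule_format, OF b]
  have r: "refl n b v \<in> Dn n" using B v by (simp add: refl_Dn)
  have hr: "ht n (refl n b v) = ht n v - ip n v b"
    using b n_ge_3 by (simp add: ht_refl ht_Delta)
  have "ip n v b \<noteq> 2" using Dn_ip_2 v B \<open>v \<noteq> b\<close> by blast
  moreover have "ip n v b \<noteq> -2"
    using Dn_ip_m2[OF v(1) B(1)] v b n_ge_3 by (auto simp: ht_vsmult ht_Delta)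
  ultimately have cases: "ip n v b = 1 \<or> ip n v b = 0 \<or> ip n v b = -1"
    using Dn_ip_range[OF v(1) B(1)] by auto
  then show pos: "0 < ht n (refl n b v)"
    using hr v ht_nonzero[OF r] by auto
  note Q = X_positive[OF r pos, rule_format, OF b]
  show "s b (X v) = X (refl n b v)"
    using cases
  proof (elim disjE)
    assume vb: "ip n v b = 1"
    then have "s b (s b (X (refl n b v))) = X (refl n b v)"
      using Q B by (simp add: ip_refl_left)
    then show ?thesis using P vb by simp
  next
    assume "ip n v b = 0"
    then show ?thesis using P by (simp add: refl_orthogonal)
  next
    assume "ip n v b = -1"
    then have "X (refl n b v) = s b (X (refl n b (refl n b v)))"
      using Q B by (simp add: ip_refl_left)
    then show ?thesis using B by (simp add: refl_refl)
  qed
qed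

end

text \<open>At the negative of a simple root \<open>a\<close> the value is forced to be
  \<open>s a (x a)\<close>, and \<open>x_self\<close> leads back from there. Every other simple
  reflection step stays within the positive or within the negative roots.\<close>

lemma (in braid_action) root_family:
  assumes x_orthogonal: "\<And>a b. \<lbrakk>a \<in> Delta n; b \<in> Delta n; ip n a b = 0\<rbrakk> \<Longrightarrow> s a (x b) = x b"
    and x_swap: "\<And>a b. \<lbrakk>a \<in> Delta n; b \<in> Delta n; ip n a b = -1\<rbrakk> \<Longrightarrow> s a (x b) = s b (x a)"
    and x_square: "\<And>a b. \<lbrakk>a \<in> Delta n; b \<in> Delta n; ip n a b = -1\<rbrakk> \<Longrightarrow> s a (s a (x b)) = x b"
    and x_self: "\<And>a. a \<in> Delta n \<Longrightarrow> s a (s a (x a)) = x a"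
  shows "\<exists>X. (\<forall>a\<in>Delta n. X a = x a) \<and> (\<forall>b\<in>Delta n. \<forall>v\<in>Dn n. s b (X v) = X (refl n b v))"
proof -
  interpret P: positive_family n s x
    by unfold_locales (fact assms)+
  \<comment> \<open>The second family gives the values at negative roots \<open>v\<close>, indexed
    by the positive roots \<open>-v\<close>.\<close>
  interpret N: positive_family n s "\<lambda>a. s a (x a)"
  proof
    fix a b assume ab: "a \<in> Delta n" "b \<in> Delta n"
    show "s a (s b (x b)) = s b (x b)" if "ip n a b = 0"
      using s_commute[OF ab that] x_orthogonal[OF ab that] by simp
    assume adj: "ip n a b = -1"
    then have adj': "ip n b a = -1" by (simp add: ip_commute)
    have xb: "x b = s a (s b (x a))"
      using x_swap[OF ab adj] x_square[OF ab adj] by simp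
    have "s a (s b (x b)) = s a (s b (s a (s b (x a))))"
      using xb by simp
    also have "\<dots> = s b (s a (s b (s b (x a))))"
      using s_braid[OF ab adj] by simp
    also have "\<dots> = s b (s a (x a))"
      using x_square[OF ab(2,1) adj'] by simp
    finally show swap: "s a (s b (x b)) = s b (s a (x a))" .
    show "s a (s a (s b (x b))) = s b (x b)"
      using swap s_braid[OF ab adj] x_swap[OF ab adj] x_square[OF ab adj] by simp
  qed
  define X where "X v = (if 0 < ht n v then P.X v else N.X (vsmult (-1) v))" for v
  have "X a = x a" if "a \<in> Delta n" for a
    using that n_ge_3 by (simp add: X_def ht_Delta P.X_simple)
  moreover have "s b (X v) = X (refl n b v)" if b: "b \<in> Delta n" and v: "v \<in> Dn n" for b v
  proof -
    have B: "b \<in> Dn n" "ip n b b = 2" "ht n b = 1"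
      using b n_ge_3 by (auto simp: Delta_Dn Dn_ip_self ht_Delta)
    have neg: "vsmult (-1) (vsmult (-1) w) = w" for w :: vec
      by (simp add: vsmult_def)
    show ?thesis
    proof (cases "0 < ht n v")
      case True
      show ?thesis
      proof (cases "v = b")
        case True
        then show ?thesis
          using B b by (simp add: X_def refl_self ht_vsmult neg P.X_simple N.X_simple)
      next
        case False
        then show ?thesis
          using P.X_step[OF v True b] True by (simp add: X_def)
      qed
    next
      case False
      let ?w = "vsmult (-1) v"
      have w: "?w \<in> Dn n" "0 < ht n ?w"
        using v False ht_nonzero[OF v] by (auto simp: vsmult_minus_Dn ht_vsmult)
      show ?thesis
      proof (cases "?w = b")
        case True
        then have "refl n b v = b"
          using B neg[of v] by (metis refl_refl refl_self)
        then show ?thesis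
          using True False B b x_self by (simp add: X_def P.X_simple N.X_simple)
      next
        case nb: False
        have "vsmult (-1) (refl n b v) = refl n b ?w"
          by (simp add: refl_vsmult)
        then show ?thesis
          using N.X_step[OF w b nb] False by (simp add: X_def ht_vsmult refl_vsmult)
      qed
    qed
  qed
  ultimately show ?thesis by blast
qed

section \<open>Weyl group orbits on pairs of roots\<close>

text \<open>Induction on the absolute value of the height treats both signs alike. Descent ends at a
  simple root or at the negative of one, and the latter is the reflection of the simple root in
  itself.\<close>

lemma root_induct [consumes 2, case_names simple reflect]:
  assumes n: "3 \<le> n" and "v \<in> Dn n"
    and simple: "\<And>a. a \<in> Delta n \<Longrightarrow> P a"
    and step: "\<And>b u. b \<in> Delta n \<Longrightarrow> u \<in> Dn n \<Longrightarrow> P u \<Longrightarrow> P (refl n b u)"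
  shows "P v"
  using \<open>v \<in> Dn n\<close>
proof (induction "nat \<bar>ht n v\<bar>" arbitrary: v rule: less_induct)
  case less
  have via: "P v" if "b \<in> Delta n" "P (refl n b v)" for b
    using step[OF that(1) _ that(2)] that(1) less.prems n
    by (simp add: refl_Dn refl_refl Delta_Dn Dn_ip_self)
  have via_IH: "P v" if b: "b \<in> Delta n" and "\<bar>ht n v - ip n v b\<bar> < \<bar>ht n v\<bar>" for b
  proof -
    have "ht n (refl n b v) = ht n v - ip n v b"
      using b n by (simp add: ht_refl ht_Delta)
    then have "P (refl n b v)"
      using that less.prems n by (intro less.hyps) (auto simp: refl_Dn Delta_Dn)
    then show ?thesis using via b by blast
  qed
  let ?w = "vsmult (-1) v"
  have w: "?w \<in> Dn n" "ht n ?w = - ht n v"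
    using less.prems by (auto simp: vsmult_minus_Dn ht_vsmult)
  have neg: "vsmult (-1) ?w = v"
    by (simp add: vsmult_def)
  consider "ht n v = 1" | "ht n v = -1" | "1 < ht n v" | "1 < - ht n v"
    using ht_nonzero[OF less.prems] by linarith
  then show ?case
  proof cases
    case 1
    then show ?thesis using simple ht_1_Delta less.prems by blast
  next
    case 2
    then have W: "?w \<in> Delta n" using w by (intro ht_1_Delta) auto
    then have "refl n ?w ?w = v"
      using neg n by (simp add: refl_self Delta_Dn Dn_ip_self)
    then show ?thesis using step[OF W w(1) simple[OF W]] by simp
  next
    case 3
    then obtain d where "d \<in> Delta n" "ip n v d = 1"
      using positive_root_descent[OF less.prems] by blast
    then show ?thesis using 3 by (intro via_IH[of d]) auto
  next
    case 4
    then obtain d where "d \<in> Delta n" "ip n ?w d = 1"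
      using positive_root_descent[of ?w n] w by auto
    then show ?thesis using 4 by (intro via_IH[of d]) (auto simp: ip_vsmult_left)
  qed
qed

definition refl_invariant :: "nat \<Rightarrow> (vec \<Rightarrow> vec \<Rightarrow> bool) \<Rightarrow> bool" where
  "refl_invariant n Q \<longleftrightarrow>
     (\<forall>b\<in>Dn n. \<forall>u\<in>Dn n. \<forall>v\<in>Dn n. Q u v \<longrightarrow> Q (refl n b u) (refl n b v))"

lemma refl_invariantD:
  "\<lbrakk>refl_invariant n Q; b \<in> Dn n; u \<in> Dn n; v \<in> Dn n; Q u v\<rbrakk> \<Longrightarrow> Q (refl n b u) (refl n b v)"
  by (simp add: refl_invariant_def)

text \<open>Every root is reached from a simple one by simple reflections, so by
  \<open>refl_conj\<close> its reflection is a product of simple reflections.\<close>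

lemma refl_invariantI:
  assumes n: "3 \<le> n"
    and step: "\<And>b u v. \<lbrakk>b \<in> Delta n; u \<in> Dn n; v \<in> Dn n; Q u v\<rbrakk> \<Longrightarrow> Q (refl n b u) (refl n b v)"
  shows "refl_invariant n Q"
  unfolding refl_invariant_def
proof
  fix b assume "b \<in> Dn n"
  with n show "\<forall>u\<in>Dn n. \<forall>v\<in>Dn n. Q u v \<longrightarrow> Q (refl n b u) (refl n b v)"
  proof (induction rule: root_induct)
    case (simple a)
    then show ?case using step by blast
  next
    case (reflect d b)
    have D: "d \<in> Dn n" "ip n d d = 2"
      using reflect n by (auto simp: Delta_Dn Dn_ip_self)
    have conj: "refl n (refl n d b) u = refl n d (refl n b (refl n d u))" for u
      using refl_conj[OF D(2), of b "refl n d u"] D by (simp add: refl_refl)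
    show ?case
    proof (intro ballI impI)
      fix u v assume uv: "u \<in> Dn n" "v \<in> Dn n" "Q u v"
      then have "Q (refl n d u) (refl n d v)"
        using step reflect by blast
      then have "Q (refl n b (refl n d u)) (refl n b (refl n d v))"
        using reflect uv D by (simp add: refl_Dn)
      then show "Q (refl n (refl n d b) u) (refl n (refl n d b) v)"
        unfolding conj using step reflect uv D by (simp add: refl_Dn)
    qed
  qed
qed

text \<open>For pairing 1 the reflection in the root \<open>u - v\<close> takes \<open>u\<close> to
  \<open>v\<close>. For pairing -1 the reflection in \<open>u + v\<close> takes \<open>u\<close> to
  \<open>-v\<close>, and the one in \<open>v\<close> finishes.\<close>

lemma root_transitive_step:
  assumes P: "\<And>b u. \<lbrakk>b \<in> Dn n; u \<in> Dn n; P u\<rbrakk> \<Longrightarrow> P (refl n b u)"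
    and u: "u \<in> Dn n" "P u" and v: "v \<in> Dn n" and "ip n u v \<noteq> 0"
  shows "P v"
proof -
  have U: "ip n u u = 2" and V: "ip n v v = 2"
    using u v by (auto simp: Dn_ip_self)
  consider "ip n u v = 2" | "ip n u v = -2" | "ip n u v = 1" | "ip n u v = -1"
    using Dn_ip_range[OF u(1) v] \<open>ip n u v \<noteq> 0\<close> by auto
  then show ?thesis
  proof cases
    case 1
    then show ?thesis using Dn_ip_2[OF u(1) v] u by simp
  next
    case 2
    then have "refl n v u = v"
      using Dn_ip_m2[OF u(1) v] V by (simp add: refl_vsmult refl_self) (simp add: vsmult_def)
    then show ?thesis using P[OF v u] by simp
  next
    case 3
    then have "refl n (refl n v u) u = v"
      using U by (intro ext) (simp add: refl_apply ip_refl_right)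
    then show ?thesis using P[OF refl_Dn[OF v u(1)] u] by simp
  next
    case 4
    let ?w = "refl n (refl n v u) u"
    have "ip n v u = -1" using 4 by (simp add: ip_commute)
    then have "refl n v ?w = v"
      using U V 4 by (intro ext) (simp add: refl_apply ip_refl_right ip_refl_left)
    moreover have "P (refl n v ?w)"
      using u v by (intro P) (auto simp: refl_Dn)
    ultimately show ?thesis by simp
  qed
qed

lemma Dn_other_coordinate:
  assumes "v \<in> Dn n" "v i \<noteq> 0"
  obtains l q where "v = rt (v i) i q l" "i \<in> {1..n}" "l \<in> {1..n}" "l \<noteq> i" "v i \<in> {1, -1}" "q \<in> {1, -1}"
  using assms(1)
proof (cases rule: Dn_cases)
  case (1 s k t l)
  then have "i = k \<or> i = l" using assms(2) by (auto simp: rt_apply split: if_splits)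
  then show thesis
  proof
    assume "i = k"
    then show thesis using 1 that[of t l] by (simp add: rt_apply)
  next
    assume "i = l"
    then show thesis using 1 that[of s k] by (simp add: rt_apply rt_commute)
  qed
qed

lemma root_transitive:
  assumes n: "3 \<le> n"
    and P: "\<And>b u. \<lbrakk>b \<in> Dn n; u \<in> Dn n; P u\<rbrakk> \<Longrightarrow> P (refl n b u)"
    and u: "u \<in> Dn n" "P u" and v: "v \<in> Dn n"
  shows "P v"
proof (cases "ip n u v = 0")
  case False
  then show ?thesis using root_transitive_step[of n P] P u v by blast
next
  case True
  obtain s i t j where u': "u = rt s i t j" "i \<in> {1..n}" "j \<in> {1..n}" "i < j" "s \<in> {1, -1}" "t \<in> {1, -1}"
    using u(1) by (rule Dn_cases)
  have orth: "s * v i + t * v j = 0"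
    using True ip_rt[OF u'(2,3), of v s t] u'(1) by (simp add: ip_commute)
  \<comment> \<open>The aim is a root \<open>eps i + eps m\<close> orthogonal to neither
    \<open>u\<close> nor \<open>v\<close>. If \<open>v i \<noteq> 0\<close>, orthogonality puts the
    support of \<open>v\<close> on \<open>{i, j}\<close> and \<open>3 \<le> n\<close> leaves a free
    index; otherwise an index in the support of \<open>v\<close> serves.\<close>
  have "\<exists>m\<in>{1..n} - {i, j}. v i + v m \<noteq> 0"
  proof (cases "v i = 0")
    case vi: False
    then have "v j \<noteq> 0" using orth u' by auto
    obtain l q where l: "v = rt (v i) i q l" "l \<noteq> i"
      using Dn_other_coordinate[OF v vi] by blast
    have "l = j" using fun_cong[OF l(1), of j] \<open>v j \<noteq> 0\<close> u' by (auto simp: rt_apply split: if_splits)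
    have "card {i, j} \<le> 2" by (simp add: card_insert_if)
    then have "\<not> {1..n} \<subseteq> {i, j}"
      using n card_mono[of "{i, j}" "{1..n}"] by auto
    then obtain m where m: "m \<in> {1..n} - {i, j}" by blast
    then have "v m = 0" using fun_cong[OF l(1), of m] \<open>l = j\<close> by (simp add: rt_apply)
    then show ?thesis using m vi by (intro bexI[of _ m]) auto
  next
    case vi: True
    then have vj: "v j = 0" using orth u' by auto
    obtain p k q l where v': "v = rt p k q l" "k \<in> {1..n}" "k < l" "p \<in> {1, -1}"
      using v by (elim Dn_cases) blast
    then have "v k \<noteq> 0" by (auto simp: rt_apply)
    then show ?thesis using vi vj v' by (intro bexI[of _ k]) auto
  qed
  then obtain m where m: "m \<in> {1..n}" "m \<noteq> i" "m \<noteq> j" "v i + v m \<noteq> 0" by blast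
  let ?w = "rt 1 i 1 m"
  have w: "?w \<in> Dn n" using m u' by (intro rt_in_Dn) auto
  have "ip n u ?w \<noteq> 0"
    using m u' by (simp add: ip_rt) (auto simp: rt_apply)
  then have "P ?w" using root_transitive_step[of n P u ?w] P u w by blast
  moreover have "ip n ?w v \<noteq> 0"
    using m u' by (simp add: ip_commute[of n ?w] ip_rt)
  ultimately show ?thesis
    using root_transitive_step[of n P ?w v] P w v by blast
qed

text \<open>That \<open>Q u v\<close> holds for all \<open>v\<close> at pairing \<open>e\<close> is
  an invariant property of \<open>u\<close> alone, so \<open>root_transitive\<close> reduces it to
  one convenient first root.\<close>

lemma pair_transitive:
  assumes n: "3 \<le> n" and Q: "refl_invariant n Q"
    and u: "u \<in> Dn n" and base: "\<And>v. v \<in> Dn n \<Longrightarrow> ip n u v = e \<Longrightarrow> Q u v"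
    and "u' \<in> Dn n" "v' \<in> Dn n" "ip n u' v' = e"
  shows "Q u' v'"
proof -
  define P where "P u \<longleftrightarrow> (\<forall>v\<in>Dn n. ip n u v = e \<longrightarrow> Q u v)" for u
  have "P (refl n b u)" if b: "b \<in> Dn n" and u: "u \<in> Dn n" "P u" for b u
    unfolding P_def
  proof (intro ballI impI)
    fix v assume v: "v \<in> Dn n" "ip n (refl n b u) v = e"
    have B: "ip n b b = 2" using b by (simp add: Dn_ip_self)
    have "ip n u (refl n b v) = e"
      using v by (simp add: ip_refl_left ip_refl_right ip_commute[of n v b] mult.commute)
    then have "Q u (refl n b v)" using u v b by (simp add: P_def refl_Dn)
    then show "Q (refl n b u) v"
      using refl_invariantD[OF Q b u(1), of "refl n b v"] v b B by (simp add: refl_Dn refl_refl)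
  qed
  moreover have "P u" using base by (simp add: P_def)
  ultimately have "P u'" using root_transitive[of n P u u'] n u assms by blast
  then show ?thesis using assms by (simp add: P_def)
qed

text \<open>The reflection in \<open>eps i + s eps j\<close> sends \<open>eps i\<close> to
  \<open>- s eps j\<close>. Such signed transpositions produce the normal forms of pairs
  below.\<close>

lemma refl_swap:
  assumes "i \<in> {1..n}" "j \<in> {1..n}" "i \<noteq> j" "k \<noteq> i" "k \<noteq> j" "s \<in> {1, -1}"
  shows "refl n (rt 1 i s j) (rt p k q i) = rt p k (- s * q) j"
  using assms by (intro ext) (auto simp: refl_apply ip_rt rt_apply)

lemma refl_rt_disjoint:
  assumes "i \<in> {1..n}" "j \<in> {1..n}" "k \<notin> {i, j}" "l \<notin> {i, j}"
  shows "refl n (rt s i t j) (rt p k q l) = rt p k q l"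
  using assms by (intro refl_orthogonal) (auto simp: ip_rt rt_apply)

text \<open>Only reflections fixing \<open>alpha 3\<close> are used: the one in
  \<open>eps 2 + eps 3\<close> exchanges \<open>eps 3\<close> with \<open>- eps 2\<close> and so
  makes \<open>v 3\<close> the non-zero one of \<open>v 2\<close> and \<open>v 3\<close>, and the
  one in \<open>eps 1 - eps l\<close> moves the remaining coordinate to place 1.\<close>

lemma pairs_ip_unit:
  assumes n: "3 \<le> n" and Q: "refl_invariant n Q" and e: "e \<in> {1, -1}"
    and base: "\<And>s. s \<in> {1, -1} \<Longrightarrow> Q (alpha 3) (rt e 3 s 1)"
    and uv: "u \<in> Dn n" "v \<in> Dn n" "ip n u v = e"
  shows "Q u v"
proof -
  have a3: "alpha 3 \<in> Dn n" using n by (intro Delta_Dn) (auto simp: Delta_def)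
  have first: "Q (alpha 3) v" if v: "v \<in> Dn n" "v 3 = e" "v 2 = 0" for v
  proof -
    have "v 3 \<noteq> 0" using v e by auto
    then obtain l q where l': "v = rt (v 3) 3 q l" "l \<in> {1..n}" "l \<noteq> 3" "q \<in> {1, -1}"
      using Dn_other_coordinate[OF v(1)] by blast
    note l = l'[unfolded v(2)]
    have l2: "l \<noteq> 2" using v l by (auto simp: rt_apply)
    show ?thesis
    proof (cases "l = 1")
      case True
      then show ?thesis using base l by simp
    next
      case False
      have "refl n (rt 1 1 (-1) l) (rt e 3 q 1) = v"
        using l False n by (simp add: refl_swap)
      moreover have "refl n (rt 1 1 (-1) l) (alpha 3) = alpha 3"
        unfolding alpha_eq_rt using l l2 False n by (intro refl_rt_disjoint) auto
      moreover have "Q (refl n (rt 1 1 (-1) l) (alpha 3)) (refl n (rt 1 1 (-1) l) (rt e 3 q 1))"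
        using l e n False a3 base by (intro refl_invariantD[OF Q] rt_in_Dn) auto
      ultimately show ?thesis by simp
    qed
  qed
  show ?thesis
  proof (rule pair_transitive[OF n Q a3 _ uv])
    fix v assume v: "v \<in> Dn n" "ip n (alpha 3) v = e"
    then have diff: "v 3 - v 2 = e"
      using n by (simp add: ip_commute[of n "alpha 3"] ip_alpha)
    show "Q (alpha 3) v"
    proof (cases "v 3 = 0")
      case False
      obtain l q where l: "v = rt (v 3) 3 q l" "v 3 \<in> {1, -1}" "q \<in> {1, -1}" "l \<noteq> 3"
        using Dn_other_coordinate[OF v(1) False] by blast
      have "v 2 = (if l = 2 then q else 0)"
        using fun_cong[OF l(1), of 2] by simp (simp add: rt_apply)
      then have "v 2 = 0" using diff l e by (auto split: if_splits)
      then show ?thesis using first v diff by simp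
    next
      case True
      let ?b = "rt 1 2 1 3"
      have b: "?b \<in> Dn n" using n by (intro rt_in_Dn) auto
      have "?b 3 = 1" "?b 2 = 1" by (auto simp: rt_apply)
      then have "Q (alpha 3) (refl n ?b v)"
        using True diff n b v by (intro first refl_Dn) (auto simp: refl_apply ip_rt)
      then have "Q (refl n ?b (alpha 3)) (refl n ?b (refl n ?b v))"
        using b v a3 by (intro refl_invariantD[OF Q]) (auto simp: refl_Dn)
      moreover have "refl n ?b (alpha 3) = alpha 3"
        using n by (intro refl_orthogonal) (simp add: ip_rt alpha_apply)
      ultimately show ?thesis using b by (simp add: refl_refl Dn_ip_self)
    qed
  qed
qed

text \<open>With first root \<open>alpha 2\<close>, the second is \<open>alpha2'\<close> up to sign
  or lives on coordinates from 3 up. For \<open>n = 4\<close> no Weyl group element fixing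
  \<open>alpha 2\<close> takes \<open>alpha 4\<close> to \<open>eps 3 + eps 4\<close>; that pair has
  to come from \<open>(alpha2', alpha 4)\<close>.\<close>

lemma pairs_orthogonal:
  assumes n: "3 \<le> n" and Q: "refl_invariant n Q"
    and base: "\<And>a b. a \<in> Delta n \<Longrightarrow> b \<in> Delta n \<Longrightarrow> ip n a b = 0 \<Longrightarrow> Q a b"
    and uv: "u \<in> Dn n" "v \<in> Dn n" "ip n u v = 0"
  shows "Q u v"
proof -
  have D2: "alpha 2 \<in> Delta n" "alpha2' \<in> Delta n"
    using n by (auto simp: Delta_def)
  note a2 = D2[THEN Delta_Dn[OF n]]
  have ip2: "ip n (alpha 2) w = w 2 - w 1" for w
    using n by (simp add: ip_commute[of n "alpha 2"] ip_alpha)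
  \<comment> \<open>The reflection in \<open>w\<close> itself fixes the orthogonal root
    \<open>alpha 2\<close> and negates \<open>w\<close>.\<close>
  have flip: "Q (alpha 2) (vsmult (-1) w)" if "w \<in> Dn n" "Q (alpha 2) w" "w 2 = w 1" for w
  proof -
    have "refl n w (alpha 2) = alpha 2"
      using that ip2 by (intro refl_orthogonal) simp
    then show ?thesis
      using refl_invariantD[OF Q that(1) a2(1) that(1,2)] that by (simp add: refl_self Dn_ip_self)
  qed
  have neg: "vsmult (-1) (rt p k q l) = rt (- p) k (- q) l" for p q k l
    by (intro ext) (simp add: vsmult_def rt_apply)
  show ?thesis
  proof (rule pair_transitive[OF n Q a2(1) _ uv])
    fix v assume v: "v \<in> Dn n" "ip n (alpha 2) v = 0"
    then have v12: "v 2 = v 1" by (simp add: ip2)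
    show "Q (alpha 2) v"
    proof (cases "v 1 = 0")
      case False
      obtain l q where l: "v = rt (v 1) 1 q l" "v 1 \<in> {1, -1}" "q \<in> {1, -1}" "l \<noteq> 1"
        using Dn_other_coordinate[OF v(1) False] by blast
      have "v 2 = (if l = 2 then q else 0)"
        using fun_cong[OF l(1), of 2] by simp (simp add: rt_apply)
      then have "l = 2" "q = v 1" using False v12 by (auto split: if_splits)
      then have "v = rt (v 1) 1 (v 1) 2" using l(1) by simp
      then have "v = alpha2' \<or> v = vsmult (-1) alpha2'"
        using l(2) by (auto simp: alpha2'_eq_rt neg)
      moreover have "Q (alpha 2) alpha2'"
        using D2 by (intro base) (auto simp: ip2 alpha2'_apply)
      ultimately show ?thesis
        using flip[OF a2(2)] by (auto simp: alpha2'_apply)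
    next
      case True
      obtain p k q l where r: "v = rt p k q l" "k \<in> {1..n}" "l \<in> {1..n}" "k < l" "p \<in> {1, -1}" "q \<in> {1, -1}"
        using v(1) by (rule Dn_cases)
      have "k \<noteq> 1" "k \<noteq> 2"
        using True v12 r by (auto simp: rt_apply)
      then have k: "3 \<le> k" using r by auto
      then have n4: "4 \<le> n" using r by auto
      have D4: "alpha 4 \<in> Delta n" using n4 by (simp add: Delta_def)
      have "Q (alpha 2) (alpha 4)"
        using D2 D4 by (intro base) (auto simp: ip2 alpha_apply)
      then have m: "Q (alpha 2) (rt (-1) 3 1 4)" by (simp add: alpha_eq_rt)
      have s1: "Q alpha2' (alpha 4)"
        using D2 D4 n4 by (intro base) (auto simp: ip_alpha alpha2'_apply)
      have s2: "Q (rt 1 2 1 1) (rt 1 4 (-1) 3)"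
        using s1 by (simp add: alpha_eq_rt alpha2'_eq_rt rt_commute[of 1 2] rt_commute[of 1 4])
      \<comment> \<open>The reflections in \<open>eps 1 + eps 3\<close> and
        \<open>eps 3 - eps 1\<close> compose to the simultaneous sign change of \<open>eps 1\<close>
        and \<open>eps 3\<close>, which takes \<open>(alpha2', alpha 4)\<close> to
        \<open>(alpha 2, eps 3 + eps 4)\<close>.\<close>
      have s3: "Q (refl n (rt 1 1 1 3) (rt 1 2 1 1)) (refl n (rt 1 3 1 1) (rt 1 4 (-1) 3))"
        unfolding rt_commute[of 1 3 1 1] using s2 n4 by (intro refl_invariantD[OF Q] rt_in_Dn) auto
      then have s4: "Q (rt 1 2 (-1) 3) (rt 1 4 1 1)"
        using n4 by (simp add: refl_swap)
      have s5: "Q (refl n (rt 1 3 (-1) 1) (rt 1 2 (-1) 3)) (refl n (rt 1 3 (-1) 1) (rt 1 4 1 1))"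
        using s4 n4 by (intro refl_invariantD[OF Q] rt_in_Dn) auto
      have "refl n (rt 1 3 (-1) 1) (rt 1 4 1 1) = rt 1 4 1 3"
        using n4 by (intro ext) (auto simp: refl_apply ip_rt rt_apply)
      moreover have "refl n (rt 1 3 (-1) 1) (rt 1 2 (-1) 3) = alpha 2"
        using n4 rt_commute[of 1 2 "-1" 1] by (simp add: refl_swap alpha_eq_rt)
      ultimately have pl: "Q (alpha 2) (rt 1 3 1 4)"
        using s5 rt_commute[of 1 4 1 3] by simp
      have l34: "Q (alpha 2) (rt p 3 q 4)"
        using r(5,6) m pl flip[OF _ m] flip[OF _ pl] n4 by (auto simp: neg rt_in_Dn rt_apply)
      \<comment> \<open>Transpositions of coordinates from 3 up fix \<open>alpha 2\<close>; they are
        used to move 4 to \<open>l\<close> and afterwards 3 to \<open>k\<close>.\<close>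
      have fix2: "refl n (rt 1 i (-1) j) (alpha 2) = alpha 2" if "3 \<le> i" "3 \<le> j" "i \<le> n" "j \<le> n" for i j
        unfolding alpha_eq_rt using that by (intro refl_rt_disjoint) auto
      have l3: "Q (alpha 2) (rt p 3 q l)"
      proof (cases "l = 4")
        case False
        have "Q (refl n (rt 1 4 (-1) l) (alpha 2)) (refl n (rt 1 4 (-1) l) (rt p 3 q 4))"
          using l34 n4 r k a2 False by (intro refl_invariantD[OF Q] rt_in_Dn) auto
        then show ?thesis
          using n4 r k False by (simp add: fix2 refl_swap)
      qed (use l34 in simp)
      show ?thesis
      proof (cases "k = 3")
        case False
        have "Q (refl n (rt 1 3 (-1) k) (alpha 2)) (refl n (rt 1 3 (-1) k) (rt q l p 3))"
          using l3 n4 r k a2 False by (intro refl_invariantD[OF Q] rt_in_Dn) (auto simp: rt_commute[of q])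
        then show ?thesis
          using n4 r k False rt_commute[of q l p k] by (simp add: fix2 refl_swap)
      qed (use l3 r in simp)
    qed
  qed
qed

text \<open>\<open>pairs_ip_unit\<close> asks for \<open>alpha 3\<close> in the first place, while
  the base pairs have it in the second. The sign \<open>s = 1\<close> is served by the pair with
  \<open>alpha 2\<close>, and \<open>s = -1\<close> by the pair with \<open>alpha2'\<close>.\<close>

lemma pairs_ip_m1:
  assumes n: "3 \<le> n" and Q: "refl_invariant n Q"
    and base: "Q (alpha 2) (alpha 3)" "Q alpha2' (alpha 3)"
    and uv: "u \<in> Dn n" "v \<in> Dn n" "ip n u v = -1"
  shows "Q u v"
proof (rule pairs_ip_unit[OF n Q _ _ uv])
  fix s :: int assume s: "s \<in> {1, -1}"
  \<comment> \<open>the signed permutation \<open>\<epsilon>\<^sub>2 \<mapsto> \<epsilon>\<^sub>3\<close>, \<open>\<epsilon>\<^sub>3 \<mapsto> s\<epsilon>\<^sub>1\<close>, \<open>\<epsilon>\<^sub>1 \<mapsto> s\<epsilon>\<^sub>2\<close> lies in the Weyl group\<close>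
  have "Q (rt (- s) 1 1 2) (rt 1 3 (-1) 2)"
    using base s by (auto simp: alpha_eq_rt alpha2'_eq_rt rt_commute[of 1 3])
  then have "Q (refl n (rt 1 2 (-1) 3) (rt (- s) 1 1 2)) (refl n (rt 1 2 (-1) 3) (rt 1 3 (-1) 2))"
    using n s by (intro refl_invariantD[OF Q] rt_in_Dn) auto
  moreover have "refl n (rt 1 2 (-1) 3) (rt (- s) 1 1 2) = rt 1 3 (- s) 1"
    using n by (simp add: refl_swap rt_commute[of 1 3])
  moreover have "refl n (rt 1 2 (-1) 3) (rt 1 3 (-1) 2) = rt (-1) 3 1 2"
    using n by (intro ext) (auto simp: refl_apply ip_rt rt_apply)
  ultimately have "Q (rt 1 3 (- s) 1) (rt (-1) 3 1 2)" by simp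
  then have "Q (refl n (rt 1 1 (- s) 2) (rt 1 3 (- s) 1)) (refl n (rt 1 1 (- s) 2) (rt (-1) 3 1 2))"
    using n s by (intro refl_invariantD[OF Q] rt_in_Dn) auto
  moreover have "refl n (rt 1 1 (- s) 2) (rt 1 3 (- s) 1) = alpha 3"
    using n s by (intro ext) (auto simp: refl_apply ip_rt rt_apply alpha_eq_rt)
  moreover have "refl n (rt 1 1 (- s) 2) (rt (-1) 3 1 2) = rt (-1) 3 s 1"
    using n s by (intro ext) (auto simp: refl_apply ip_rt rt_apply)
  ultimately show "Q (alpha 3) (rt (-1) 3 s 1)" by simp
qed simp

section \<open>Steinberg elements in the parametrized braid group\<close>

locale BrA_family = group G for G (structure) +
  fixes n :: nat and Y :: "vec \<Rightarrow> 'r::comm_ring_1 \<Rightarrow> 'a"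
  assumes n_ge_3: "3 \<le> n"
    and Y_closed [simp]: "a \<in> Delta n \<Longrightarrow> Y a r \<in> carrier G"
    and Y_A1: "a \<in> Delta n \<Longrightarrow> Y a r \<otimes> (Y a 0 \<otimes> Y a t) = Y a 0 \<otimes> (Y a 0 \<otimes> Y a (r + t))"
    and Y_A1A1: "\<lbrakk>a \<in> Delta n; b \<in> Delta n; ip n a b = 0\<rbrakk> \<Longrightarrow> Y a r \<otimes> Y b t = Y b t \<otimes> Y a r"
    and Y_A2: "\<lbrakk>a \<in> Delta n; b \<in> Delta n; adj_lt n a b\<rbrakk> \<Longrightarrow>
      Y a r \<otimes> (Y b t \<otimes> Y a c) = Y b c \<otimes> (Y a (t + r * c) \<otimes> Y b r)"
begin

definition y :: "vec \<Rightarrow> 'a" where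
  "y a = Y a 0"

definition x :: "vec \<Rightarrow> 'r \<Rightarrow> 'a" where
  "x a r = Y a r \<otimes> inv y a"

text \<open>Extended by the identity outside the carrier, so that the braid relations hold on the whole type.\<close>

definition s :: "vec \<Rightarrow> 'a \<Rightarrow> 'a" where
  "s b g = (if g \<in> carrier G then y b \<otimes> g \<otimes> inv y b else g)"

lemma y_closed [simp]: "a \<in> Delta n \<Longrightarrow> y a \<in> carrier G"
  by (simp add: y_def)

lemma x_closed [simp]: "a \<in> Delta n \<Longrightarrow> x a r \<in> carrier G"
  by (simp add: x_def)

lemma s_closed [simp]: "b \<in> Delta n \<Longrightarrow> s b g \<in> carrier G \<longleftrightarrow> g \<in> carrier G"
  by (simp add: s_def)

lemma inv_cancel: "\<lbrakk>g \<in> carrier G; h \<in> carrier G\<rbrakk> \<Longrightarrow> inv g \<otimes> (g \<otimes> h) = h"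
    "\<lbrakk>g \<in> carrier G; h \<in> carrier G\<rbrakk> \<Longrightarrow> g \<otimes> (inv g \<otimes> h) = h"
  by (simp_all add: m_assoc[symmetric])

lemma Y_eq: "a \<in> Delta n \<Longrightarrow> Y a r = x a r \<otimes> y a"
  by (simp add: x_def m_assoc)

lemma x_zero: "a \<in> Delta n \<Longrightarrow> x a 0 = \<one>"
  by (simp add: x_def y_def)

text \<open>As a rewrite rule this carries \<open>y b\<close> to the right past \<open>g\<close> at
  the price of applying \<open>s b\<close>, so that \<open>x\<close>'s gather on the left and
  \<open>y\<close>'s on the right.\<close>

lemma y_move_assoc:
  "\<lbrakk>b \<in> Delta n; g \<in> carrier G; h \<in> carrier G\<rbrakk> \<Longrightarrow> y b \<otimes> (g \<otimes> h) = s b g \<otimes> (y b \<otimes> h)"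
  by (simp add: s_def m_assoc inv_cancel)

lemma s_mult:
  "\<lbrakk>b \<in> Delta n; g \<in> carrier G; h \<in> carrier G\<rbrakk> \<Longrightarrow> s b (g \<otimes> h) = s b g \<otimes> s b h"
  by (simp add: s_def m_assoc inv_cancel)

lemma s_fixI: "\<lbrakk>b \<in> Delta n; g \<in> carrier G; y b \<otimes> g = g \<otimes> y b\<rbrakk> \<Longrightarrow> s b g = g"
  by (simp add: s_def m_assoc)

lemma s_s: "\<lbrakk>a \<in> Delta n; b \<in> Delta n; g \<in> carrier G\<rbrakk> \<Longrightarrow> s a (s b g) = (y a \<otimes> y b) \<otimes> g \<otimes> inv (y a \<otimes> y b)"
  by (simp add: s_def m_assoc inv_mult_group)

lemma s_s_s: "\<lbrakk>a \<in> Delta n; b \<in> Delta n; c \<in> Delta n; g \<in> carrier G\<rbrakk> \<Longrightarrow>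
    s a (s b (s c g)) = (y a \<otimes> (y b \<otimes> y c)) \<otimes> g \<otimes> inv (y a \<otimes> (y b \<otimes> y c))"
  by (simp add: s_def m_assoc inv_mult_group)

lemma ip_adj:
  assumes "a \<in> Delta n" "b \<in> Delta n" "ip n a b = -1"
  shows "adj_lt n a b \<or> adj_lt n b a"
proof -
  have "a \<noteq> b" using assms n_ge_3 Dn_ip_self[OF Delta_Dn] by force
  then show ?thesis
    using ip_Delta[OF n_ge_3 assms(1,2)] assms(3) by (auto simp: adjacent_def split: if_splits)
qed

lemma y_commute: "\<lbrakk>a \<in> Delta n; b \<in> Delta n; ip n a b = 0\<rbrakk> \<Longrightarrow> y a \<otimes> y b = y b \<otimes> y a"
  using Y_A1A1[of a b 0 0] by (simp add: y_def)

lemma y_braid: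
  assumes "a \<in> Delta n" "b \<in> Delta n" "ip n a b = -1"
  shows "y a \<otimes> (y b \<otimes> y a) = y b \<otimes> (y a \<otimes> y b)"
  using ip_adj[OF assms] Y_A2[of a b 0 0 0] Y_A2[of b a 0 0 0] assms by (auto simp: y_def)

lemma braid_action: "braid_action n s"
proof
  fix a b g assume ab: "a \<in> Delta n" "b \<in> Delta n"
  show "s a (s b g) = s b (s a g)" if "ip n a b = 0"
  proof (cases "g \<in> carrier G")
    case True
    then show ?thesis using ab y_commute[OF ab that] by (simp add: s_s)
  qed (simp add: s_def)
  show "s a (s b (s a g)) = s b (s a (s b g))" if "ip n a b = -1"
  proof (cases "g \<in> carrier G")
    case True
    then show ?thesis using ab y_braid[OF ab that] by (simp add: s_s_s)
  qed (simp add: s_def)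
qed (rule n_ge_3)

text \<open>The case \<open>t = 0\<close> of \<open>Y_A1\<close>, with one \<open>y a\<close>
  cancelled. It supplies the condition \<open>x_self\<close> of \<open>root_family\<close>.\<close>

lemma x_square_commute:
  assumes a: "a \<in> Delta n"
  shows "x a r \<otimes> (y a \<otimes> y a) = (y a \<otimes> y a) \<otimes> x a r"
proof -
  have "(x a r \<otimes> (y a \<otimes> y a)) \<otimes> y a = ((y a \<otimes> y a) \<otimes> x a r) \<otimes> y a"
    using Y_A1[OF a, of r 0] Y_eq[OF a, of r] a by (simp add: y_def[symmetric] m_assoc)
  then show ?thesis using a by (subst (asm) right_cancel) auto
qed

lemma s_s_self: "a \<in> Delta n \<Longrightarrow> s a (s a (x a r)) = x a r"
  by (subst s_s, simp_all flip: x_square_commute) (simp add: m_assoc)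

text \<open>Once the square of \<open>y a\<close> is moved to the front by
  \<open>x_square_commute\<close>, \<open>Y_A1\<close> is additivity in the parameter.\<close>

lemma x_add:
  assumes a: "a \<in> Delta n"
  shows "x a r \<otimes> x a t = x a (r + t)"
proof -
  have "(x a r \<otimes> (y a \<otimes> y a)) \<otimes> (x a t \<otimes> y a) = (y a \<otimes> y a) \<otimes> (x a (r + t) \<otimes> y a)"
    using Y_A1[OF a, of r t] a by (simp add: Y_eq[of a r] Y_eq[of a t] Y_eq[of a "r + t"] y_def[symmetric] m_assoc)
  then have "(y a \<otimes> y a) \<otimes> ((x a r \<otimes> x a t) \<otimes> y a) = (y a \<otimes> y a) \<otimes> (x a (r + t) \<otimes> y a)"
    unfolding x_square_commute[OF a] using a by (simp add: m_assoc)
  then show ?thesis using a by simp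
qed

text \<open>Parameter 0 on one side of \<open>Y_A1A1\<close> shows that \<open>y\<close> of one root
  commutes with \<open>x\<close> of the other; after that the \<open>y\<close>'s cancel from the
  general relation.\<close>

lemma x_orthogonal:
  assumes "a \<in> Delta n" "b \<in> Delta n" "ip n a b = 0"
  shows "s a (x b r) = x b r" "x a t \<otimes> x b r = x b r \<otimes> x a t"
proof -
  have ba: "ip n b a = 0" using assms by (simp add: ip_commute)
  have fix_x: "s c (x d t) = x d t" if "c \<in> Delta n" "d \<in> Delta n" "ip n c d = 0" for c d t
  proof -
    have "y c \<otimes> (x d t \<otimes> y d) = (x d t \<otimes> y d) \<otimes> y c"
      using Y_A1A1[OF that, of 0 t] Y_eq[OF that(2), of t] by (simp add: y_def[of c])
    then have "(y c \<otimes> x d t) \<otimes> y d = (x d t \<otimes> y c) \<otimes> y d"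
      using that y_commute[OF that] by (simp add: m_assoc)
    then have "y c \<otimes> x d t = x d t \<otimes> y c"
      using that by (subst (asm) right_cancel) auto
    then show ?thesis using that by (intro s_fixI) auto
  qed
  show "s a (x b r) = x b r" using fix_x assms by blast
  have "(x a t \<otimes> y a) \<otimes> (x b r \<otimes> y b) = (x b r \<otimes> y b) \<otimes> (x a t \<otimes> y a)"
    using Y_A1A1[OF assms, of t r] assms by (simp add: Y_eq)
  then have "(x a t \<otimes> x b r) \<otimes> (y a \<otimes> y b) = (x b r \<otimes> x a t) \<otimes> (y a \<otimes> y b)"
    using assms fix_x[OF assms] fix_x[OF assms(2,1) ba] y_commute[OF assms]
    by (simp add: m_assoc y_move_assoc)
  then show "x a t \<otimes> x b r = x b r \<otimes> x a t"
    using assms by (subst (asm) right_cancel) auto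
qed

text \<open>Relation (A2) with all \<open>y\<close>'s moved to the right end, where the braid
  relation allows them to be cancelled.\<close>

lemma x_adjacent_raw:
  assumes ab: "a \<in> Delta n" "b \<in> Delta n" "adj_lt n a b"
  shows "x a r \<otimes> (s a (x b t) \<otimes> s a (s b (x a c))) =
    x b c \<otimes> (s b (x a (t + r * c)) \<otimes> s b (s a (x b r)))"
proof -
  have br: "y a \<otimes> (y b \<otimes> y a) = y b \<otimes> (y a \<otimes> y b)"
    using Y_A2[OF ab, of 0 0 0] by (simp add: y_def)
  have "(x a r \<otimes> y a) \<otimes> ((x b t \<otimes> y b) \<otimes> (x a c \<otimes> y a)) =
      (x b c \<otimes> y b) \<otimes> ((x a (t + r * c) \<otimes> y a) \<otimes> (x b r \<otimes> y b))"
    using Y_A2[OF ab, of r t c] ab by (simp add: Y_eq)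
  then have "(x a r \<otimes> (s a (x b t) \<otimes> s a (s b (x a c)))) \<otimes> (y a \<otimes> (y b \<otimes> y a)) =
    (x b c \<otimes> (s b (x a (t + r * c)) \<otimes> s b (s a (x b r)))) \<otimes> (y b \<otimes> (y a \<otimes> y b))"
    using ab by (simp add: m_assoc y_move_assoc)
  then show ?thesis
    unfolding br using ab by (subst (asm) right_cancel) auto
qed

text \<open>Each clause is \<open>x_adjacent_raw\<close> with some parameters 0: only the middle,
  the last or the first one free for the action; middle 0 for the commutator formula; first 0 for
  the commutation. The element \<open>s b (x a t)\<close> plays the part of the root
  \<open>a + b\<close>.\<close>

lemma x_adjacent:
  assumes ab: "a \<in> Delta n" "b \<in> Delta n" "adj_lt n a b"
  shows "s a (x b t) = s b (x a t)" "s a (s b (x a t)) = x b t" "s b (s a (x b t)) = x a t"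
    and "x a r \<otimes> x b c = x b c \<otimes> (s b (x a (r * c)) \<otimes> x a r)"
    and "x b c \<otimes> s a (x b t) = s a (x b t) \<otimes> x b c"
proof -
  have one: "s d \<one> = \<one>" if "d \<in> Delta n" for d
    using that by (simp add: s_def)
  note raw = x_adjacent_raw[OF ab]
  show 1: "s a (x b t) = s b (x a t)" for t
    using raw[of 0 t 0] ab by (simp add: x_zero one)
  show 2: "s a (s b (x a t)) = x b t" for t
    using raw[of 0 0 t] ab by (simp add: x_zero one)
  show 3: "s b (s a (x b t)) = x a t" for t
    using raw[of t 0 0] ab by (simp add: x_zero one)
  show "x a r \<otimes> x b c = x b c \<otimes> (s b (x a (r * c)) \<otimes> x a r)"
    using raw[of r 0 c] ab 2 3 by (simp add: x_zero one)
  show "x b c \<otimes> s a (x b t) = s a (x b t) \<otimes> x b c"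
    using raw[of 0 t c] ab 1 2 by (simp add: x_zero one)
qed

lemma x_swap:
  assumes "a \<in> Delta n" "b \<in> Delta n" "ip n a b = -1"
  shows "s a (x b r) = s b (x a r)" "s a (s a (x b r)) = x b r"
  using ip_adj[OF assms] x_adjacent[of a b] x_adjacent[of b a] assms by auto

lemma steinberg_family:
  "\<exists>X. (\<forall>v\<in>Dn n. \<forall>r. X v r \<in> carrier G) \<and>
    (\<forall>a\<in>Delta n. \<forall>r. X a r = x a r) \<and>
    (\<forall>b\<in>Delta n. \<forall>v\<in>Dn n. \<forall>r. X (refl n b v) r = y b \<otimes> X v r \<otimes> inv y b) \<and>
    (\<forall>v\<in>Dn n. \<forall>r t. X v r \<otimes> X v t = X v (r + t)) \<and>
    (\<forall>u\<in>Dn n. \<forall>v\<in>Dn n. vadd u v \<notin> Dn n \<and> vadd u v \<noteq> vzero \<longrightarrow>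
      (\<forall>r t. X u r \<otimes> X v t = X v t \<otimes> X u r)) \<and>
    (\<forall>u\<in>Dn n. \<forall>v\<in>Dn n. vadd u v \<in> Dn n \<longrightarrow>
      (\<forall>r t. X u r \<otimes> X v t = X v t \<otimes> (X (vadd u v) (r * t) \<otimes> X u r)))"
proof -
  interpret braid_action n s by (rule braid_action)
  \<comment> \<open>\<open>root_family\<close> is applied to each parameter \<open>r\<close>
    separately, since its conditions never mix parameters.\<close>
  have "\<forall>r. \<exists>X. (\<forall>a\<in>Delta n. X a = x a r) \<and> (\<forall>b\<in>Delta n. \<forall>v\<in>Dn n. s b (X v) = X (refl n b v))"
    using x_orthogonal(1) x_swap s_s_self by (intro allI root_family) blast+
  then obtain X' where X': "\<And>r a. a \<in> Delta n \<Longrightarrow> X' r a = x a r"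
      "\<And>r b v. b \<in> Delta n \<Longrightarrow> v \<in> Dn n \<Longrightarrow> s b (X' r v) = X' r (refl n b v)"
    by metis
  define X where "X v r = X' r v" for v r
  have X: "X a r = x a r" if "a \<in> Delta n" for a r
    using X' that by (simp add: X_def)
  have sX: "s b (X v r) = X (refl n b v) r" if "b \<in> Delta n" "v \<in> Dn n" for b v r
    using X' that by (simp add: X_def)
  have closed: "X v r \<in> carrier G" if "v \<in> Dn n" for v r
    using n_ge_3 that by (induction rule: root_induct) (auto simp: X sX[symmetric])
  have add: "\<forall>r t. X v r \<otimes> X v t = X v (r + t)" if "v \<in> Dn n" for v
    using n_ge_3 that by (induction rule: root_induct)
      (auto simp: X x_add sX[symmetric] s_mult[symmetric] closed)
  \<comment> \<open>Conjugation by the \<open>y b\<close> preserves both properties.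
    \<open>E\<close> includes that the sum is a root, so that \<open>sX\<close> also applies to the
    factor belonging to the sum.\<close>
  define C where "C u v \<longleftrightarrow> (\<forall>r t. X u r \<otimes> X v t = X v t \<otimes> X u r)" for u v
  define E where "E u v \<longleftrightarrow> vadd u v \<in> Dn n \<and> (\<forall>r t. X u r \<otimes> X v t = X v t \<otimes> (X (vadd u v) (r * t) \<otimes> X u r))" for u v
  have C: "refl_invariant n C"
    using n_ge_3 by (intro refl_invariantI) (auto simp: C_def sX[symmetric] s_mult[symmetric] closed)
  have E: "refl_invariant n E"
  proof (intro refl_invariantI n_ge_3)
    fix b u v assume b: "b \<in> Delta n" and uv: "u \<in> Dn n" "v \<in> Dn n" "E u v"
    show "E (refl n b u) (refl n b v)"
      using uv b n_ge_3 unfolding E_def refl_vadd[symmetric]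
      by (simp add: sX[symmetric] s_mult[symmetric] closed refl_Dn Delta_Dn)
  qed
  have D: "alpha 2 \<in> Delta n" "alpha2' \<in> Delta n" "alpha 3 \<in> Delta n"
    using n_ge_3 by (auto simp: Delta_def)
  note D' = D[THEN Delta_Dn[OF n_ge_3]]
  have adj: "adj_lt n (alpha 2) (alpha 3)" "adj_lt n alpha2' (alpha 3)"
    by (auto simp: adj_lt_def)
  have ip23: "ip n (alpha 2) (alpha 3) = -1" "ip n alpha2' (alpha 3) = -1"
    using n_ge_3 by (auto simp: ip_alpha alpha_apply alpha2'_apply)
  \<comment> \<open>As \<open>refl n a (alpha 3)\<close> is \<open>a + alpha 3\<close>, the second
    claim is the commutation of a pair of roots with inner product 1.\<close>
  have base: "E a (alpha 3)" "C (alpha 3) (refl n a (alpha 3))"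
    if a: "a \<in> Delta n" "adj_lt n a (alpha 3)" "ip n a (alpha 3) = -1" for a
  proof -
    note aD = Delta_Dn[OF n_ge_3 a(1)]
    have "refl n (alpha 3) a = vadd a (alpha 3)" using a by (simp add: refl_eq_vadd)
    then have "X (vadd a (alpha 3)) r = s (alpha 3) (x a r)" for r
      using sX[OF D(3) aD] a X by metis
    then show "E a (alpha 3)"
      using x_adjacent(4)[OF a(1) D(3) a(2)] a D aD D' by (simp add: E_def X Dn_vadd_iff)
    show "C (alpha 3) (refl n a (alpha 3))"
      using x_adjacent(5)[OF a(1) D(3) a(2)] a D D' by (simp add: C_def sX[symmetric] X)
  qed
  have Em1: "E u v" if "u \<in> Dn n" "v \<in> Dn n" "ip n u v = -1" for u v
    by (rule pairs_ip_m1[OF n_ge_3 E base(1) base(1) that]) (fact D adj ip23)+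
  have C1: "C u v" if "u \<in> Dn n" "v \<in> Dn n" "ip n u v = 1" for u v
  proof (rule pairs_ip_unit[OF n_ge_3 C _ _ that])
    fix e :: int assume "e \<in> {1, -1}"
    \<comment> \<open>The sums \<open>alpha 2 + alpha 3\<close> and \<open>alpha2' + alpha 3\<close>
      are precisely the two representatives that \<open>pairs_ip_unit\<close> asks for.\<close>
    moreover have "refl n (alpha 2) (alpha 3) = rt 1 3 (-1) 1" "refl n alpha2' (alpha 3) = rt 1 3 1 1"
      using n_ge_3 by (auto simp: fun_eq_iff refl_apply ip_alpha ip_alpha2' alpha_apply alpha2'_apply rt_apply)
    ultimately show "C (alpha 3) (rt 1 3 e 1)"
      using base(2)[OF D(1) adj(1) ip23(1)] base(2)[OF D(2) adj(2) ip23(2)] by auto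
  qed simp
  have C0: "C u v" if "u \<in> Dn n" "v \<in> Dn n" "ip n u v = 0" for u v
    by (rule pairs_orthogonal[OF n_ge_3 C _ that]) (simp add: C_def X, blast intro: x_orthogonal(2))
  \<comment> \<open>Pairing 2 means equal roots, whose sum is neither a root nor zero; commutation
    then comes from additivity.\<close>
  have C2: "C v v" if "v \<in> Dn n" for v
    using add[OF that] by (simp add: C_def add.commute)
  have "C u v" if "u \<in> Dn n" "v \<in> Dn n" "vadd u v \<notin> Dn n" "vadd u v \<noteq> vzero" for u v
    using Dn_ip_range[OF that(1,2)] that C0 C1 C2 Dn_ip_2[OF that(1,2)]
    by (auto simp: Dn_vadd_iff Dn_vadd_eq_zero_iff)
  moreover have "E u v" if "u \<in> Dn n" "v \<in> Dn n" "vadd u v \<in> Dn n" for u v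
    using Em1 that by (simp add: Dn_vadd_iff)
  moreover have "X (refl n b v) r = y b \<otimes> X v r \<otimes> inv y b" if "b \<in> Delta n" "v \<in> Dn n" for b v r
    using sX[OF that] closed that by (simp add: s_def)
  ultimately show ?thesis
    using closed X add unfolding C_def E_def by (intro exI[of _ X]) auto
qed

end

section \<open>The action of the braid group on the Steinberg group\<close>

lemma weyl_of_Nil [simp]: "weyl_of n [] = id"
  and weyl_of_Cons [simp]: "weyl_of n (x # w) = refl n (fst x) \<circ> weyl_of n w"
  by (simp_all add: weyl_of_def)

lemma weyl_of_append [simp]: "weyl_of n (u @ v) = weyl_of n u \<circ> weyl_of n v"
  by (induction u) (auto simp: comp_assoc)

lemma Br_rels_cases:
  assumes "(l, r) \<in> Br_rels n"
  obtains (comm) a b where "l = pw [a, b]" "r = pw [b, a]" "a \<in> Delta n" "b \<in> Delta n"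
      "a \<noteq> b" "\<not> adjacent n a b"
    | (braid) a b where "l = pw [a, b, a]" "r = pw [b, a, b]" "a \<in> Delta n" "b \<in> Delta n"
      "adjacent n a b"
  using assms unfolding Br_rels_def by blast

lemma St_rels_cases:
  assumes "(l, r) \<in> St_rels n"
  obtains (add) \<alpha> a b where "l = pw [(\<alpha>, a), (\<alpha>, b)]" "r = pw [(\<alpha>, a + b)]" "\<alpha> \<in> Dn n"
    | (comm) \<alpha> \<beta> a b where "l = pw [(\<alpha>, a), (\<beta>, b)]" "r = pw [(\<beta>, b), (\<alpha>, a)]"
      "\<alpha> \<in> Dn n" "\<beta> \<in> Dn n" "vadd \<alpha> \<beta> \<notin> Dn n" "vadd \<alpha> \<beta> \<noteq> vzero"
    | (sum) \<alpha> \<beta> a b where "l = pw [(\<alpha>, a), (\<beta>, b)]" "r = pw [(\<beta>, b), (vadd \<alpha> \<beta>, a * b), (\<alpha>, a)]"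
      "\<alpha> \<in> Dn n" "\<beta> \<in> Dn n" "vadd \<alpha> \<beta> \<in> Dn n"
  using assms unfolding St_rels_def by blast

text \<open>For orthogonal roots \<open>refl n a\<close> fixes \<open>b\<close>, so
  \<open>refl_conj\<close> reads as commutation; for adjacent ones this is
  \<open>refl_braid\<close>. It makes the Weyl group element of a braid class well defined.\<close>

lemma weyl_of_rel:
  assumes n: "3 \<le> n" and "(l, r) \<in> Br_rels n"
  shows "weyl_of n l = weyl_of n r"
  using assms(2)
proof (cases rule: Br_rels_cases)
  case (comm a b)
  then have "ip n a b = 0" "ip n a a = 2"
    using ip_Delta[of n a b] n by (auto simp: Delta_Dn Dn_ip_self)
  then have "refl n a (refl n b v) = refl n b (refl n a v)" for v
    using refl_conj[of n a b v] by (simp add: refl_orthogonal ip_commute)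
  then show ?thesis using comm by (simp add: pw_def fun_eq_iff)
next
  case (braid a b)
  have "a \<noteq> b"
    using braid n by (auto elim!: Delta_cases simp: adjacent_def adj_lt_iff)
  then have "ip n a b = -1" "ip n a a = 2" "ip n b b = 2"
    using ip_Delta[of n a b] n braid by (auto simp: Delta_Dn Dn_ip_self)
  then have "refl n a (refl n b (refl n a v)) = refl n b (refl n a (refl n b v))" for v
    by (rule refl_braid[rotated 2])
  then show ?thesis using braid by (simp add: pw_def comp_def)
qed

lemma weyl_of_cong:
  assumes n: "3 \<le> n" and "pres_eq (Delta n) (Br_rels n) u v"
  shows "weyl_of n u = weyl_of n v"
  using assms(2)
proof (induction rule: pres_eq.induct)
  case (pe_cancel u v g b)
  then show ?case using n by (simp add: fun_eq_iff refl_refl Delta_Dn Dn_ip_self)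
next
  case (pe_rel u v l r)
  then show ?case using weyl_of_rel[OF n] by simp
qed auto

text \<open>The properties that transport Steinberg relations. They are equivalences because the
  side conditions "not a root" and "not zero" must be carried over as well.\<close>

definition root_auto :: "nat \<Rightarrow> (vec \<Rightarrow> vec) \<Rightarrow> bool" where
  "root_auto n \<sigma> \<longleftrightarrow> (\<forall>u v. \<sigma> (vadd u v) = vadd (\<sigma> u) (\<sigma> v)) \<and>
     (\<forall>v. \<sigma> v \<in> Dn n \<longleftrightarrow> v \<in> Dn n) \<and> (\<forall>v. \<sigma> v = vzero \<longleftrightarrow> v = vzero)"

lemma root_auto_weyl:
  assumes n: "3 \<le> n" and "w \<in> words_on (Delta n)"
  shows "root_auto n (weyl_of n w)"
  using assms(2)
proof (induction w)
  case Nil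
  then show ?case by (simp add: root_auto_def)
next
  case (Cons x w)
  have D: "fst x \<in> Dn n" "ip n (fst x) (fst x) = 2"
    using Cons.prems n by (auto simp: Delta_Dn Dn_ip_self)
  have zero: "refl n (fst x) vzero = vzero"
    by (simp add: refl_def vzero_def ip_def)
  have "refl n (fst x) v = vzero \<longleftrightarrow> v = vzero" for v
    using refl_refl[OF D(2), of v] zero by auto
  then show ?case
    using Cons D by (simp add: root_auto_def refl_vadd refl_Dn_iff)
qed

lemma act_word_append [simp]: "act_word \<sigma> (u @ v) = act_word \<sigma> u @ act_word \<sigma> v"
  and act_word_pw: "act_word \<sigma> (pw gs) = pw (map (\<lambda>(\<gamma>, a). (\<sigma> \<gamma>, a)) gs)"
  and act_word_id [simp]: "act_word id u = u"
  and act_word_comp: "act_word (\<sigma> \<circ> \<tau>) u = act_word \<sigma> (act_word \<tau> u)"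
  by (auto simp: act_word_def pw_def case_prod_beta)

lemma act_word_words_on:
  "root_auto n \<sigma> \<Longrightarrow> act_word \<sigma> u \<in> words_on (St_gens n) \<longleftrightarrow> u \<in> words_on (St_gens n)"
  by (auto simp: act_word_def words_on_def St_gens_def root_auto_def case_prod_beta)

lemma act_word_rel:
  assumes \<sigma>: "root_auto n \<sigma>" and "(l, r) \<in> St_rels n"
  shows "(act_word \<sigma> l, act_word \<sigma> r) \<in> St_rels n"
proof -
  have add: "\<sigma> (vadd u v) = vadd (\<sigma> u) (\<sigma> v)" for u v
    using \<sigma> by (simp add: root_auto_def)
  have mem: "\<sigma> v \<in> Dn n \<longleftrightarrow> v \<in> Dn n" "\<sigma> v = vzero \<longleftrightarrow> v = vzero" for v
    using \<sigma> by (auto simp: root_auto_def)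
  show ?thesis
    using assms(2)
  proof (cases rule: St_rels_cases)
    case (add \<alpha> a b)
    then have "(act_word \<sigma> l, act_word \<sigma> r) = (pw [(\<sigma> \<alpha>, a), (\<sigma> \<alpha>, b)], pw [(\<sigma> \<alpha>, a + b)])" "\<sigma> \<alpha> \<in> Dn n"
      by (simp_all add: act_word_pw mem)
    then show ?thesis unfolding St_rels_def by blast
  next
    case (comm \<alpha> \<beta> a b)
    then have "(act_word \<sigma> l, act_word \<sigma> r) = (pw [(\<sigma> \<alpha>, a), (\<sigma> \<beta>, b)], pw [(\<sigma> \<beta>, b), (\<sigma> \<alpha>, a)])"
      "\<sigma> \<alpha> \<in> Dn n" "\<sigma> \<beta> \<in> Dn n" "vadd (\<sigma> \<alpha>) (\<sigma> \<beta>) \<notin> Dn n" "vadd (\<sigma> \<alpha>) (\<sigma> \<beta>) \<noteq> vzero"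
      by (simp_all add: act_word_pw mem flip: add)
    then show ?thesis unfolding St_rels_def by blast
  next
    case (sum \<alpha> \<beta> a b)
    then have "(act_word \<sigma> l, act_word \<sigma> r) =
        (pw [(\<sigma> \<alpha>, a), (\<sigma> \<beta>, b)], pw [(\<sigma> \<beta>, b), (vadd (\<sigma> \<alpha>) (\<sigma> \<beta>), a * b), (\<sigma> \<alpha>, a)])"
      "\<sigma> \<alpha> \<in> Dn n" "\<sigma> \<beta> \<in> Dn n" "vadd (\<sigma> \<alpha>) (\<sigma> \<beta>) \<in> Dn n"
      by (simp_all add: act_word_pw mem flip: add)
    then show ?thesis unfolding St_rels_def by blast
  qed
qed

lemma act_word_cong:
  assumes \<sigma>: "root_auto n \<sigma>" and "pres_eq (St_gens n) (St_rels n) u v"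
  shows "pres_eq (St_gens n) (St_rels n) (act_word \<sigma> u) (act_word \<sigma> v)"
  using assms(2)
proof (induction rule: pres_eq.induct)
  case (pe_refl w)
  then show ?case using \<sigma> by (intro pres_eq.pe_refl) (simp add: act_word_words_on)
next
  case (pe_sym u v)
  show ?case by (rule pres_eq.pe_sym[OF pe_sym.IH])
next
  case (pe_trans u v w)
  show ?case by (rule pres_eq.pe_trans[OF pe_trans.IH])
next
  case (pe_cancel u v g b)
  have "act_word \<sigma> (u @ [(g, b), (g, \<not> b)] @ v) =
      act_word \<sigma> u @ [((\<sigma> (fst g), snd g), b), ((\<sigma> (fst g), snd g), \<not> b)] @ act_word \<sigma> v"
    by (simp add: act_word_def case_prod_beta)
  moreover have "(\<sigma> (fst g), snd g) \<in> St_gens n"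
    using pe_cancel \<sigma> by (auto simp: St_gens_def root_auto_def)
  ultimately show ?case
    using pres_eq.pe_cancel[of "act_word \<sigma> u" "St_gens n" "act_word \<sigma> v"] pe_cancel \<sigma>
    by (simp add: act_word_words_on)
next
  case (pe_rel u v l r)
  then show ?case
    using pres_eq.pe_rel[OF _ _ act_word_rel[OF \<sigma> pe_rel.hyps(3)], of "act_word \<sigma> u" "St_gens n" "act_word \<sigma> v"] \<sigma>
    by (simp add: act_word_words_on)
qed

text \<open>Neither the Weyl group element nor the class of the moved word depends on the
  representatives, so the union in \<open>br_act\<close> collapses to one class.\<close>

lemma br_act_pclass:
  assumes n: "3 \<le> n" and w: "w \<in> words_on (Delta n)" and v: "v \<in> words_on (St_gens n)"
  shows "br_act n (pclass (Delta n) (Br_rels n) w) (pclass (St_gens n) (St_rels n) v) =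
    pclass (St_gens n) (St_rels n) (act_word (weyl_of n w) v)"
    (is "br_act n ?W ?V = ?R")
proof -
  have "pclass (St_gens n) (St_rels n) (act_word (weyl_of n w') v') = ?R"
    if "w' \<in> ?W" "v' \<in> ?V" for w' v'
  proof -
    have "weyl_of n w = weyl_of n w'"
      using that n by (intro weyl_of_cong) (simp_all add: pclass_def)
    moreover have "pres_eq (St_gens n) (St_rels n) (act_word (weyl_of n w) v) (act_word (weyl_of n w) v')"
      using that n w by (intro act_word_cong root_auto_weyl) (simp_all add: pclass_def)
    ultimately show ?thesis
      using pclass_eqI[symmetric] by metis
  qed
  then have "br_act n ?W ?V = (\<Union>w'\<in>?W. \<Union>v'\<in>?V. ?R)"
    unfolding br_act_def by (intro SUP_cong HOL.refl)
  also have "\<dots> = ?R"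
    using pclass_self[OF w] pclass_self[OF v] by auto
  finally show ?thesis .
qed

lemma br_act_pgen:
  assumes "3 \<le> n" "b \<in> Delta n" "v \<in> Dn n"
  shows "br_act n (pgen (Delta n) (Br_rels n) b) (pgen (St_gens n) (St_rels n) (v, a)) =
    pgen (St_gens n) (St_rels n) (refl n b v, a)"
  using br_act_pclass[of n "[(b, True)]" "[((v, a), True)]"] assms
  by (simp add: pgen_def act_word_def St_gens_def)

lemma group_St [simp]: "group (St n)" and group_Br [simp]: "group (Br n)" and group_BrA [simp]: "group (BrA n)"
  by (simp_all add: St_def Br_def BrA_def)

lemma carrier_St: "carrier (St n) = pclass (St_gens n) (St_rels n) ` words_on (St_gens n)"
  and carrier_Br: "carrier (Br n) = pclass (Delta n) (Br_rels n) ` words_on (Delta n)"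
  by (simp_all add: St_def Br_def presented_carrier)

lemma mult_St: "\<lbrakk>u \<in> words_on (St_gens n); v \<in> words_on (St_gens n)\<rbrakk> \<Longrightarrow>
    pclass (St_gens n) (St_rels n) u \<otimes>\<^bsub>St n\<^esub> pclass (St_gens n) (St_rels n) v =
    pclass (St_gens n) (St_rels n) (u @ v)"
  and mult_Br: "\<lbrakk>w \<in> words_on (Delta n); z \<in> words_on (Delta n)\<rbrakk> \<Longrightarrow>
    pclass (Delta n) (Br_rels n) w \<otimes>\<^bsub>Br n\<^esub> pclass (Delta n) (Br_rels n) z =
    pclass (Delta n) (Br_rels n) (w @ z)"
  by (simp_all add: St_def Br_def presented_mult)

lemma br_act_hom:
  assumes "3 \<le> n" "B \<in> carrier (Br n)"
  shows "br_act n B \<in> hom (St n) (St n)"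
  using assms(2) unfolding carrier_Br
proof
  fix w assume w: "B = pclass (Delta n) (Br_rels n) w" "w \<in> words_on (Delta n)"
  note auto = root_auto_weyl[OF assms(1) w(2)]
  show ?thesis
    by (rule homI) (auto simp: w br_act_pclass assms(1) carrier_St act_word_words_on[OF auto]
        mult_St)
qed

lemma br_act_one:
  assumes "3 \<le> n" "S \<in> carrier (St n)"
  shows "br_act n \<one>\<^bsub>Br n\<^esub> S = S"
  using assms by (auto simp: carrier_St Br_def presented_one br_act_pclass)

lemma br_act_mult:
  assumes "3 \<le> n" "B \<in> carrier (Br n)" "C \<in> carrier (Br n)" "S \<in> carrier (St n)"
  shows "br_act n (B \<otimes>\<^bsub>Br n\<^esub> C) S = br_act n B (br_act n C S)"
  using assms by (auto simp: carrier_St carrier_Br mult_Br br_act_pclass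
      act_word_words_on root_auto_weyl act_word_comp)

lemma group_StBr:
  assumes "3 \<le> n"
  shows "group (StBr n :: ((vec \<times> 'a::comm_ring_1) word set \<times> vec word set) monoid)"
  unfolding StBr_def using assms by (intro group_semidirect) (auto simp: br_act_hom br_act_one br_act_mult)

section \<open>The isomorphism\<close>

lemma pclass_pw_rel:
  assumes "(pw gs, pw hs) \<in> R" "set gs \<subseteq> S" "set hs \<subseteq> S"
  shows "pclass S R (pw gs) = pclass S R (pw hs)"
  using assms by (intro pclass_rel) auto

lemma in_St_gens [simp]: "(\<gamma>, a) \<in> St_gens n \<longleftrightarrow> \<gamma> \<in> Dn n"
  and in_BrA_gens [simp]: "(\<alpha>, a) \<in> BrA_gens n \<longleftrightarrow> \<alpha> \<in> Delta n"
  by (simp_all add: St_gens_def BrA_gens_def)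

abbreviation (input) xs :: "nat \<Rightarrow> vec \<Rightarrow> 'a::comm_ring_1 \<Rightarrow> (vec \<times> 'a) word set" where
  "xs n \<gamma> a \<equiv> pgen (St_gens n) (St_rels n) (\<gamma>, a)"

abbreviation (input) ys :: "nat \<Rightarrow> vec \<Rightarrow> vec word set" where
  "ys n \<alpha> \<equiv> pgen (Delta n) (Br_rels n) \<alpha>"

lemma xs_closed [simp]: "\<gamma> \<in> Dn n \<Longrightarrow> xs n \<gamma> a \<in> carrier (St n)"
  by (simp add: St_def St_gens_def)

lemma ys_closed [simp]: "\<alpha> \<in> Delta n \<Longrightarrow> ys n \<alpha> \<in> carrier (Br n)"
  by (simp add: Br_def)

lemma pw_St:
  "set gs \<subseteq> Dn n \<times> UNIV \<Longrightarrow> \<gamma> \<in> Dn n \<Longrightarrow>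
    pclass (St_gens n) (St_rels n) (pw ((\<gamma>, a) # gs)) =
    xs n \<gamma> a \<otimes>\<^bsub>St n\<^esub> pclass (St_gens n) (St_rels n) (pw gs)"
  unfolding St_def by (intro pclass_pw_Cons) (auto simp: St_gens_def)

lemma pw_Br:
  "set gs \<subseteq> Delta n \<Longrightarrow> \<alpha> \<in> Delta n \<Longrightarrow>
    pclass (Delta n) (Br_rels n) (pw (\<alpha> # gs)) = ys n \<alpha> \<otimes>\<^bsub>Br n\<^esub> pclass (Delta n) (Br_rels n) (pw gs)"
  unfolding Br_def by (rule pclass_pw_Cons)

lemma pw_BrA:
  "set gs \<subseteq> Delta n \<times> UNIV \<Longrightarrow> \<alpha> \<in> Delta n \<Longrightarrow>
    pclass (BrA_gens n) (BrA_rels n) (pw ((\<alpha>, a) # gs)) =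
    pgen (BrA_gens n) (BrA_rels n) (\<alpha>, a) \<otimes>\<^bsub>BrA n\<^esub> pclass (BrA_gens n) (BrA_rels n) (pw gs)"
  unfolding BrA_def by (intro pclass_pw_Cons) (auto simp: BrA_gens_def)

lemma xs_add:
  assumes "\<gamma> \<in> Dn n"
  shows "xs n \<gamma> a \<otimes>\<^bsub>St n\<^esub> xs n \<gamma> b = xs n \<gamma> (a + b)"
proof -
  have "(pw [(\<gamma>, a), (\<gamma>, b)], pw [(\<gamma>, a + b)]) \<in> St_rels n"
    using assms unfolding St_rels_def by blast
  from pclass_pw_rel[OF this, of "St_gens n"] show ?thesis
    using assms by (simp add: pw_St pclass_pw_single)
qed

text \<open>An element of a group that equals its own square is trivial.\<close>

lemma xs_zero:
  assumes "\<gamma> \<in> Dn n"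
  shows "xs n \<gamma> (0::'a::comm_ring_1) = \<one>\<^bsub>St n\<^esub>"
proof -
  interpret group "St n :: (vec \<times> 'a) word set monoid" by simp
  show ?thesis using xs_add[OF assms, of "0::'a" 0] assms by simp
qed

lemma xs_commute:
  assumes "\<gamma> \<in> Dn n" "\<delta> \<in> Dn n" "vadd \<gamma> \<delta> \<notin> Dn n" "vadd \<gamma> \<delta> \<noteq> vzero"
  shows "xs n \<gamma> a \<otimes>\<^bsub>St n\<^esub> xs n \<delta> b = xs n \<delta> b \<otimes>\<^bsub>St n\<^esub> xs n \<gamma> a"
proof -
  have "(pw [(\<gamma>, a), (\<delta>, b)], pw [(\<delta>, b), (\<gamma>, a)]) \<in> St_rels n"
    using assms unfolding St_rels_def by blast
  from pclass_pw_rel[OF this, of "St_gens n"] show ?thesis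
    using assms by (simp add: pw_St pclass_pw_single)
qed

lemma xs_sum:
  assumes "\<gamma> \<in> Dn n" "\<delta> \<in> Dn n" "vadd \<gamma> \<delta> \<in> Dn n"
  shows "xs n \<gamma> a \<otimes>\<^bsub>St n\<^esub> xs n \<delta> b = xs n \<delta> b \<otimes>\<^bsub>St n\<^esub> (xs n (vadd \<gamma> \<delta>) (a * b) \<otimes>\<^bsub>St n\<^esub> xs n \<gamma> a)"
proof -
  have "(pw [(\<gamma>, a), (\<delta>, b)], pw [(\<delta>, b), (vadd \<gamma> \<delta>, a * b), (\<gamma>, a)]) \<in> St_rels n"
    using assms unfolding St_rels_def by blast
  from pclass_pw_rel[OF this, of "St_gens n"] show ?thesis
    using assms by (simp add: pw_St pclass_pw_single)
qed

lemma ys_commute: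
  assumes "\<alpha> \<in> Delta n" "\<beta> \<in> Delta n" "\<alpha> \<noteq> \<beta>" "\<not> adjacent n \<alpha> \<beta>"
  shows "ys n \<alpha> \<otimes>\<^bsub>Br n\<^esub> ys n \<beta> = ys n \<beta> \<otimes>\<^bsub>Br n\<^esub> ys n \<alpha>"
proof -
  have "(pw [\<alpha>, \<beta>], pw [\<beta>, \<alpha>]) \<in> Br_rels n"
    using assms unfolding Br_rels_def by blast
  from pclass_pw_rel[OF this, of "Delta n"] show ?thesis
    using assms by (simp add: pw_Br pclass_pw_single)
qed

lemma ys_braid:
  assumes "\<alpha> \<in> Delta n" "\<beta> \<in> Delta n" "adjacent n \<alpha> \<beta>"
  shows "ys n \<alpha> \<otimes>\<^bsub>Br n\<^esub> (ys n \<beta> \<otimes>\<^bsub>Br n\<^esub> ys n \<alpha>) = ys n \<beta> \<otimes>\<^bsub>Br n\<^esub> (ys n \<alpha> \<otimes>\<^bsub>Br n\<^esub> ys n \<beta>)"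
proof -
  have "(pw [\<alpha>, \<beta>, \<alpha>], pw [\<beta>, \<alpha>, \<beta>]) \<in> Br_rels n"
    using assms unfolding Br_rels_def by blast
  from pclass_pw_rel[OF this, of "Delta n"] show ?thesis
    using assms by (simp add: pw_Br pclass_pw_single)
qed

lemma adj_lt_ip:
  assumes "3 \<le> n" "a \<in> Delta n" "b \<in> Delta n" "adj_lt n a b"
  shows "ip n a b = -1"
proof -
  have "a \<noteq> b"
    using assms by (auto elim!: Delta_cases simp: adj_lt_iff)
  then show ?thesis using ip_Delta[OF assms(1-3)] assms(4) by (simp add: adjacent_def)
qed

lemma ip_zero_nonadjacent:
  assumes "3 \<le> n" "a \<in> Delta n" "b \<in> Delta n"
  shows "ip n a b = 0 \<longleftrightarrow> a \<noteq> b \<and> \<not> adjacent n a b"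
  using ip_Delta[OF assms] Dn_ip_self[OF Delta_Dn[OF assms(1,2)]] by (cases "a = b") auto

lemma word_eval_pw:
  "word_eval K f (pw []) = \<one>\<^bsub>K\<^esub>" "word_eval K f (pw (g # gs)) = f g \<otimes>\<^bsub>K\<^esub> word_eval K f (pw gs)"
  by (simp_all add: pw_def letter_eval_def)

lemma StBr_simps:
  "carrier (StBr n) = carrier (St n) \<times> carrier (Br n)"
  "(g, h) \<otimes>\<^bsub>StBr n\<^esub> (g', h') = (g \<otimes>\<^bsub>St n\<^esub> br_act n h g', h \<otimes>\<^bsub>Br n\<^esub> h')"
  "\<one>\<^bsub>StBr n\<^esub> = (\<one>\<^bsub>St n\<^esub>, \<one>\<^bsub>Br n\<^esub>)"
  by (simp_all add: StBr_def semidirect_simps)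

lemma BrA_family_BrA:
  assumes n: "3 \<le> n"
  shows "BrA_family (BrA n) n (\<lambda>\<alpha> a::'a::comm_ring_1. pgen (BrA_gens n) (BrA_rels n) (\<alpha>, a))"
proof (intro BrA_family.intro BrA_family_axioms.intro)
  let ?Y = "\<lambda>\<alpha> a::'a. pgen (BrA_gens n) (BrA_rels n) (\<alpha>, a)"
  let ?G = "BrA n :: (vec \<times> 'a) word set monoid"
  show "?Y a r \<in> carrier ?G" if "a \<in> Delta n" for a r
    using that by (simp add: BrA_def BrA_gens_def)
  fix a b :: vec and r t c :: 'a
  show "?Y a r \<otimes>\<^bsub>?G\<^esub> (?Y a 0 \<otimes>\<^bsub>?G\<^esub> ?Y a t) = ?Y a 0 \<otimes>\<^bsub>?G\<^esub> (?Y a 0 \<otimes>\<^bsub>?G\<^esub> ?Y a (r + t))"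
    if "a \<in> Delta n"
  proof -
    have "(pw [(a, r), (a, 0), (a, t)], pw [(a, 0), (a, 0), (a, r + t)]) \<in> BrA_rels n"
      using that unfolding BrA_rels_def by blast
    from pclass_pw_rel[OF this, of "BrA_gens n"] show ?thesis
      using that by (simp add: pw_BrA pclass_pw_single)
  qed
  show "?Y a r \<otimes>\<^bsub>?G\<^esub> ?Y b t = ?Y b t \<otimes>\<^bsub>?G\<^esub> ?Y a r"
    if "a \<in> Delta n" "b \<in> Delta n" "ip n a b = 0"
  proof -
    have "(pw [(a, r), (b, t)], pw [(b, t), (a, r)]) \<in> BrA_rels n"
      using that ip_zero_nonadjacent[OF n that(1,2)] unfolding BrA_rels_def by blast
    from pclass_pw_rel[OF this, of "BrA_gens n"] show ?thesis
      using that by (simp add: pw_BrA pclass_pw_single)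
  qed
  show "?Y a r \<otimes>\<^bsub>?G\<^esub> (?Y b t \<otimes>\<^bsub>?G\<^esub> ?Y a c) = ?Y b c \<otimes>\<^bsub>?G\<^esub> (?Y a (t + r * c) \<otimes>\<^bsub>?G\<^esub> ?Y b r)"
    if "a \<in> Delta n" "b \<in> Delta n" "adj_lt n a b"
  proof -
    have "(pw [(a, r), (b, t), (a, c)], pw [(b, c), (a, t + r * c), (b, r)]) \<in> BrA_rels n"
      using that unfolding BrA_rels_def by blast
    from pclass_pw_rel[OF this, of "BrA_gens n"] show ?thesis
      using that by (simp add: pw_BrA pclass_pw_single)
  qed
qed (use n in simp_all)

lemma presentation_map_phi:
  assumes n: "3 \<le> n"
  shows "presentation_map (StBr n) (BrA_gens n) (BrA_rels n)
    (\<lambda>(\<alpha>, a::'a::comm_ring_1). (xs n \<alpha> a, ys n \<alpha>))"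
proof (intro presentation_map.intro presentation_map_axioms.intro group_StBr n)
  let ?f = "\<lambda>(\<alpha>, a::'a). (xs n \<alpha> a, ys n \<alpha>)"
  interpret S: group "St n :: (vec \<times> 'a) word set monoid" by simp
  interpret B: group "Br n" by simp
  have Dn [simp]: "\<alpha> \<in> Dn n" "ip n \<alpha> \<alpha> = 2" if "\<alpha> \<in> Delta n" for \<alpha>
    using n that by (simp_all add: Delta_Dn Dn_ip_self)
  show "?f g \<in> carrier (StBr n)" if "g \<in> BrA_gens n" for g
    using that by (auto simp: BrA_gens_def StBr_simps)
  have act_mult: "br_act n (ys n \<alpha>) (g \<otimes>\<^bsub>St n\<^esub> h) = br_act n (ys n \<alpha>) g \<otimes>\<^bsub>St n\<^esub> br_act n (ys n \<alpha>) h"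
    if "\<alpha> \<in> Delta n" "g \<in> carrier (St n)" "h \<in> carrier (St n)" for \<alpha> and g h :: "(vec \<times> 'a) word set"
    using br_act_hom[OF n ys_closed[OF that(1)]] that(2,3) by (auto simp: hom_def)
  have act_one: "br_act n (ys n \<alpha>) \<one>\<^bsub>St n\<^esub> = (\<one>\<^bsub>St n\<^esub> :: (vec \<times> 'a) word set)" if "\<alpha> \<in> Delta n" for \<alpha>
    using hom_one[OF br_act_hom[OF n ys_closed[OF that]]] by simp
  note calc = word_eval_pw StBr_simps act_mult act_one br_act_pgen[OF n] xs_zero refl_refl refl_Dn
  fix l r assume "(l, r) \<in> (BrA_rels n :: ((vec \<times> 'a) word \<times> _) set)"
  then consider
      (A1) \<alpha> a b where "l = pw [(\<alpha>, a), (\<alpha>, 0), (\<alpha>, b)]" "r = pw [(\<alpha>, 0), (\<alpha>, 0), (\<alpha>, a + b)]" "\<alpha> \<in> Delta n"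
    | (A1A1) \<alpha> \<beta> a b where "l = pw [(\<alpha>, a), (\<beta>, b)]" "r = pw [(\<beta>, b), (\<alpha>, a)]"
        "\<alpha> \<in> Delta n" "\<beta> \<in> Delta n" "\<alpha> \<noteq> \<beta>" "\<not> adjacent n \<alpha> \<beta>"
    | (A2) \<alpha> \<beta> a b c where "l = pw [(\<alpha>, a), (\<beta>, b), (\<alpha>, c)]" "r = pw [(\<beta>, c), (\<alpha>, b + a * c), (\<beta>, a)]"
        "\<alpha> \<in> Delta n" "\<beta> \<in> Delta n" "adj_lt n \<alpha> \<beta>"
    unfolding BrA_rels_def by blast
  then show "word_eval (StBr n) ?f l = word_eval (StBr n) ?f r"
  proof cases
    case A1
    \<comment> \<open>On both sides the last factor is acted on twice by the reflection in
      \<open>\<alpha>\<close>, hence unchanged.\<close>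
    then show ?thesis by (simp add: calc xs_add)
  next
    case A1A1
    then have ip: "ip n \<alpha> \<beta> = 0" "ip n \<beta> \<alpha> = 0"
      using ip_zero_nonadjacent[OF n] by (auto simp: ip_commute)
    have "xs n \<alpha> a \<otimes>\<^bsub>St n\<^esub> xs n \<beta> b = xs n \<beta> b \<otimes>\<^bsub>St n\<^esub> xs n \<alpha> a"
      using A1A1 ip Dn_vadd_eq_zero_iff[of \<alpha> n \<beta>] by (intro xs_commute) (auto simp: Dn_vadd_iff)
    then show ?thesis
      using A1A1 ip ys_commute[OF A1A1(3-6)] by (simp add: calc refl_orthogonal)
  next
    case A2
    have ip: "ip n \<alpha> \<beta> = -1" "ip n \<beta> \<alpha> = -1"
      using adj_lt_ip[OF n A2(3-5)] by (auto simp: ip_commute)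
    let ?\<gamma> = "vadd \<alpha> \<beta>"
    have \<gamma>: "?\<gamma> \<in> Dn n" using A2 ip by (simp add: Dn_vadd_iff)
    have r: "refl n \<alpha> \<beta> = ?\<gamma>" "refl n \<beta> \<alpha> = ?\<gamma>"
      using ip by (auto simp: refl_eq_vadd vadd_def)
    have r2: "refl n \<alpha> ?\<gamma> = \<beta>" "refl n \<beta> ?\<gamma> = \<alpha>"
      using r A2 by (metis Dn(2) refl_refl)+
    have ip\<gamma>: "ip n ?\<gamma> \<alpha> = 1" "ip n ?\<gamma> \<beta> = 1"
      using ip A2 by (simp_all add: ip_vadd_left)
    have comm: "xs n ?\<gamma> p \<otimes>\<^bsub>St n\<^esub> xs n \<delta> q = xs n \<delta> q \<otimes>\<^bsub>St n\<^esub> xs n ?\<gamma> p" if "\<delta> = \<alpha> \<or> \<delta> = \<beta>" for p q :: 'a and \<delta>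
      using that A2 \<gamma> ip\<gamma> Dn_vadd_eq_zero_iff[of ?\<gamma> n \<delta>] by (intro xs_commute) (auto simp: Dn_vadd_iff)
    \<comment> \<open>This is the Steinberg component of the left side: the reflection in
      \<open>\<alpha>\<close> takes \<open>\<beta>\<close> to \<open>?\<gamma>\<close>, and preceded
      by the one in \<open>\<beta>\<close> it takes \<open>\<alpha>\<close> to
      \<open>\<beta>\<close>. The sum relation and the commutation with \<open>?\<gamma>\<close>
      convert it to the right side.\<close>
    have "xs n \<alpha> a \<otimes>\<^bsub>St n\<^esub> (xs n ?\<gamma> b \<otimes>\<^bsub>St n\<^esub> xs n \<beta> c) = xs n \<alpha> a \<otimes>\<^bsub>St n\<^esub> (xs n \<beta> c \<otimes>\<^bsub>St n\<^esub> xs n ?\<gamma> b)"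
      using comm by simp
    also have "\<dots> = xs n \<beta> c \<otimes>\<^bsub>St n\<^esub> (xs n ?\<gamma> (a * c) \<otimes>\<^bsub>St n\<^esub> (xs n \<alpha> a \<otimes>\<^bsub>St n\<^esub> xs n ?\<gamma> b))"
      using xs_sum[of \<alpha> n \<beta> a c] A2 \<gamma> by (simp flip: S.m_assoc)
    also have "\<dots> = xs n \<beta> c \<otimes>\<^bsub>St n\<^esub> (xs n ?\<gamma> (a * c) \<otimes>\<^bsub>St n\<^esub> (xs n ?\<gamma> b \<otimes>\<^bsub>St n\<^esub> xs n \<alpha> a))"
      using comm by simp
    also have "\<dots> = xs n \<beta> c \<otimes>\<^bsub>St n\<^esub> (xs n ?\<gamma> (b + a * c) \<otimes>\<^bsub>St n\<^esub> xs n \<alpha> a)"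
      using A2 \<gamma> by (simp add: xs_add add.commute flip: S.m_assoc)
    finally have "xs n \<alpha> a \<otimes>\<^bsub>St n\<^esub> (xs n ?\<gamma> b \<otimes>\<^bsub>St n\<^esub> xs n \<beta> c) =
      xs n \<beta> c \<otimes>\<^bsub>St n\<^esub> (xs n ?\<gamma> (b + a * c) \<otimes>\<^bsub>St n\<^esub> xs n \<alpha> a)" .
    then show ?thesis
      using A2 \<gamma> ys_braid[of \<alpha> n \<beta>] by (simp add: calc r r2 adjacent_def)
  qed
qed

theorem theorem3p5:
  fixes n :: nat
  assumes "n \<ge> 3"
  shows "\<exists>\<phi>. \<phi> \<in> iso (BrA n :: (vec \<times> 'a::comm_ring_1) word set monoid) (StBr n) \<and>
           (\<forall>\<alpha>\<in>Delta n. \<forall>a::'a.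
              \<phi> (pgen (BrA_gens n) (BrA_rels n) (\<alpha>, a)) =
                (pgen (St_gens n) (St_rels n) (\<alpha>, a), pgen (Delta n) (Br_rels n) \<alpha>))"
proof -
  let ?G = "BrA n :: (vec \<times> 'a) word set monoid"
  let ?St = "St n :: (vec \<times> 'a) word set monoid"
  let ?SB = "StBr n :: ((vec \<times> 'a) word set \<times> vec word set) monoid"
  let ?Y = "\<lambda>\<alpha> a::'a. pgen (BrA_gens n) (BrA_rels n) (\<alpha>, a)"
  interpret F: BrA_family ?G n ?Y by (rule BrA_family_BrA[OF assms])
  interpret S: group ?St by simp
  interpret B: group "Br n" by simp
  interpret SB: group ?SB by (rule group_StBr[OF assms])
  have Dn [simp]: "\<alpha> \<in> Dn n" "ip n \<alpha> \<alpha> = 2" if "\<alpha> \<in> Delta n" for \<alpha>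
    using assms that by (simp_all add: Delta_Dn Dn_ip_self)
  from F.steinberg_family obtain X where X:
    "\<forall>v\<in>Dn n. \<forall>r. X v r \<in> carrier ?G"
    "\<forall>a\<in>Delta n. \<forall>r. X a r = F.x a r"
    "\<forall>b\<in>Delta n. \<forall>v\<in>Dn n. \<forall>r. X (refl n b v) r = F.y b \<otimes>\<^bsub>?G\<^esub> X v r \<otimes>\<^bsub>?G\<^esub> inv\<^bsub>?G\<^esub> F.y b"
    "\<forall>v\<in>Dn n. \<forall>r t. X v r \<otimes>\<^bsub>?G\<^esub> X v t = X v (r + t)"
    "\<forall>u\<in>Dn n. \<forall>v\<in>Dn n. vadd u v \<notin> Dn n \<and> vadd u v \<noteq> vzero \<longrightarrow>
      (\<forall>r t. X u r \<otimes>\<^bsub>?G\<^esub> X v t = X v t \<otimes>\<^bsub>?G\<^esub> X u r)"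
    "\<forall>u\<in>Dn n. \<forall>v\<in>Dn n. vadd u v \<in> Dn n \<longrightarrow>
      (\<forall>r t. X u r \<otimes>\<^bsub>?G\<^esub> X v t = X v t \<otimes>\<^bsub>?G\<^esub> (X (vadd u v) (r * t) \<otimes>\<^bsub>?G\<^esub> X u r))"
    by (elim exE conjE) (rule that)
  note closed = X(1)[rule_format] and X_simple = X(2)[rule_format] and equiv = X(3)[rule_format]
    and X_add = X(4)[rule_format] and X_comm = X(5)[rule_format, OF _ _ conjI] and X_sum = X(6)[rule_format]

  interpret phi: presentation_map ?SB "BrA_gens n" "BrA_rels n" "\<lambda>(\<alpha>, a::'a). (xs n \<alpha> a, ys n \<alpha>)"
    by (rule presentation_map_phi[OF assms])
  interpret f: presentation_map ?G "St_gens n" "St_rels n" "\<lambda>(\<gamma>, a::'a). X \<gamma> a"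
  proof
    show "(case g of (\<gamma>, a) \<Rightarrow> X \<gamma> a) \<in> carrier ?G" if "g \<in> St_gens n" for g
      using that closed by (auto simp: St_gens_def)
    show "word_eval ?G (\<lambda>(\<gamma>, a). X \<gamma> a) l = word_eval ?G (\<lambda>(\<gamma>, a). X \<gamma> a) r"
      if "(l, r) \<in> St_rels n" for l r
      using that
    proof (cases rule: St_rels_cases)
      case (comm \<alpha> \<beta> a b)
      then show ?thesis using X_comm[of \<alpha> \<beta> a b] by (simp add: word_eval_pw closed)
    qed (simp_all add: word_eval_pw closed X_add X_sum)
  qed
  interpret g: presentation_map ?G "Delta n" "Br_rels n" F.y
  proof
    show "word_eval ?G F.y l = word_eval ?G F.y r" if "(l, r) \<in> Br_rels n" for l r
      using that
    proof (cases rule: Br_rels_cases)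
      case (comm a b)
      then show ?thesis
        using F.y_commute[of a b] ip_zero_nonadjacent[OF assms, of a b] by (simp add: word_eval_pw)
    next
      case (braid a b)
      then have "ip n a b = -1"
        using adj_lt_ip[OF assms] ip_commute[of n a b] by (auto simp: adjacent_def)
      then show ?thesis
        using F.y_braid[of a b] braid by (simp add: word_eval_pw)
    qed
  qed simp
  define \<phi> where "\<phi> = pres_lift ?SB (\<lambda>(\<alpha>, a::'a). (xs n \<alpha> a, ys n \<alpha>))"
  define f where "f = pres_lift ?G (\<lambda>(\<gamma>, a::'a). X \<gamma> a)"
  define g where "g = pres_lift ?G F.y"
  have \<phi>: "\<phi> \<in> hom ?G ?SB" and f: "f \<in> hom ?St ?G" and g: "g \<in> hom (Br n) ?G"
    using phi.pres_lift_hom f.pres_lift_hom g.pres_lift_hom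
    by (simp_all add: \<phi>_def f_def g_def BrA_def St_def Br_def)
  interpret \<phi>: group_hom ?G ?SB \<phi> using \<phi> by unfold_locales
  interpret f: group_hom ?St ?G f using f by unfold_locales
  interpret g: group_hom "Br n" ?G g using g by unfold_locales
  have \<phi>_gen: "\<phi> (?Y \<alpha> a) = (xs n \<alpha> a, ys n \<alpha>)" if "\<alpha> \<in> Delta n" for \<alpha> a
    using that phi.pres_lift_pgen[of "(\<alpha>, a)"] by (simp add: \<phi>_def)
  have f_gen: "f (xs n \<gamma> a) = X \<gamma> a" if "\<gamma> \<in> Dn n" for \<gamma> a
    using that f.pres_lift_pgen[of "(\<gamma>, a)"] by (simp add: f_def)
  have g_gen: "g (ys n \<alpha>) = F.y \<alpha>" if "\<alpha> \<in> Delta n" for \<alpha>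
    using that g.pres_lift_pgen[of \<alpha>] by (simp add: g_def)
  have St_eqI: "h T = k T" if "group K" "h \<in> hom ?St K" "k \<in> hom ?St K" "T \<in> carrier ?St"
    "\<And>\<gamma> a. \<gamma> \<in> Dn n \<Longrightarrow> h (xs n \<gamma> a) = k (xs n \<gamma> a)" for K :: "(_, _) monoid_scheme" and h k T
    using that presented_hom_eqI[of K h "St_gens n" "St_rels n" k T] by (auto simp: St_def St_gens_def)
  have act_closed [simp]: "br_act n b T \<in> carrier ?St" if "b \<in> carrier (Br n)" "T \<in> carrier ?St" for b T
    using br_act_hom[OF assms that(1)] that(2) by (auto simp: hom_def)

  \<comment> \<open>Both sides are homomorphisms in \<open>T\<close>, so generators suffice, and
    there the claim is the equivariance of \<open>X\<close>.\<close>
  have equiv_gen: "F.y \<alpha> \<otimes>\<^bsub>?G\<^esub> f T \<otimes>\<^bsub>?G\<^esub> inv\<^bsub>?G\<^esub> F.y \<alpha> = f (br_act n (ys n \<alpha>) T)"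
    if \<alpha>: "\<alpha> \<in> Delta n" and T: "T \<in> carrier ?St" for \<alpha> T
  proof (rule St_eqI[OF _ _ _ T])
    show "(\<lambda>T. F.y \<alpha> \<otimes>\<^bsub>?G\<^esub> f T \<otimes>\<^bsub>?G\<^esub> inv\<^bsub>?G\<^esub> F.y \<alpha>) \<in> hom ?St ?G"
      using \<alpha> by (intro homI) (auto simp: F.m_assoc F.inv_cancel)
    show "(\<lambda>T. f (br_act n (ys n \<alpha>) T)) \<in> hom ?St ?G"
      using hom_compose[OF br_act_hom[OF assms ys_closed[OF \<alpha>]] f] by (simp add: comp_def)
    show "F.y \<alpha> \<otimes>\<^bsub>?G\<^esub> f (xs n \<gamma> a) \<otimes>\<^bsub>?G\<^esub> inv\<^bsub>?G\<^esub> F.y \<alpha> = f (br_act n (ys n \<alpha>) (xs n \<gamma> a))"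
      if "\<gamma> \<in> Dn n" for \<gamma> a
      using that \<alpha> assms by (simp add: f_gen br_act_pgen refl_Dn equiv)
  qed simp
  \<comment> \<open>Stated without inverses, so that it can be multiplied up letter by letter. This
    is the compatibility that makes \<open>\<psi>\<close> multiplicative.\<close>
  have equiv_all: "g b \<otimes>\<^bsub>?G\<^esub> f T = f (br_act n b T) \<otimes>\<^bsub>?G\<^esub> g b"
    if b: "b \<in> carrier (Br n)" and T: "T \<in> carrier ?St" for b T
  proof -
    have letter: "g (pclass (Delta n) (Br_rels n) [x]) \<otimes>\<^bsub>?G\<^esub> f T =
        f (br_act n (pclass (Delta n) (Br_rels n) [x]) T) \<otimes>\<^bsub>?G\<^esub> g (pclass (Delta n) (Br_rels n) [x])"
      if x: "fst x \<in> Delta n" and T: "T \<in> carrier ?St" for x T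
    proof -
      obtain \<alpha> e where xe: "x = (\<alpha>, e)" by (cases x)
      have \<alpha>: "\<alpha> \<in> Delta n" using x xe by simp
      let ?a = "ys n \<alpha>"
      have true: "g ?a \<otimes>\<^bsub>?G\<^esub> f T = f (br_act n ?a T) \<otimes>\<^bsub>?G\<^esub> g ?a" if "T \<in> carrier ?St" for T
        using equiv_gen[OF \<alpha> that, symmetric] \<alpha> that by (simp add: g_gen F.m_assoc)
      show ?thesis
      proof (cases e)
        case True
        then show ?thesis using true[OF T] xe by (simp add: pgen_def)
      next
        case False
        then have c: "pclass (Delta n) (Br_rels n) [x] = inv\<^bsub>Br n\<^esub> ?a"
          using pclass_letter_False[OF \<alpha>] xe by (simp add: Br_def)
        \<comment> \<open>An inverse letter is handled by applying \<open>true\<close> to the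
          element that \<open>?a\<close> moves to \<open>T\<close>.\<close>
        let ?U = "br_act n (inv\<^bsub>Br n\<^esub> ?a) T"
        have U: "?U \<in> carrier ?St" using \<alpha> T by simp
        have "br_act n ?a ?U = T"
          using \<alpha> T by (simp add: br_act_mult[OF assms, symmetric] br_act_one[OF assms])
        then have "g ?a \<otimes>\<^bsub>?G\<^esub> f ?U = f T \<otimes>\<^bsub>?G\<^esub> g ?a"
          using true[OF U] by simp
        then have "inv\<^bsub>?G\<^esub> g ?a \<otimes>\<^bsub>?G\<^esub> (g ?a \<otimes>\<^bsub>?G\<^esub> f ?U) \<otimes>\<^bsub>?G\<^esub> inv\<^bsub>?G\<^esub> g ?a =
            inv\<^bsub>?G\<^esub> g ?a \<otimes>\<^bsub>?G\<^esub> (f T \<otimes>\<^bsub>?G\<^esub> g ?a) \<otimes>\<^bsub>?G\<^esub> inv\<^bsub>?G\<^esub> g ?a"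
          by simp
        then show ?thesis
          unfolding c using U T \<alpha> by (simp add: F.m_assoc F.inv_cancel)
      qed
    qed
    have "g (pclass (Delta n) (Br_rels n) w) \<otimes>\<^bsub>?G\<^esub> f T =
        f (br_act n (pclass (Delta n) (Br_rels n) w) T) \<otimes>\<^bsub>?G\<^esub> g (pclass (Delta n) (Br_rels n) w)"
      if "w \<in> words_on (Delta n)" for w
      using that
    proof (induction w)
      case Nil
      have "pclass (Delta n) (Br_rels n) [] = \<one>\<^bsub>Br n\<^esub>" by (simp add: Br_def presented_one)
      then show ?case using T by (simp add: br_act_one[OF assms])
    next
      case (Cons x w)
      let ?c = "pclass (Delta n) (Br_rels n) [x]" and ?w = "pclass (Delta n) (Br_rels n) w"
      have xw: "pclass (Delta n) (Br_rels n) (x # w) = ?c \<otimes>\<^bsub>Br n\<^esub> ?w"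
        using Cons.prems mult_Br[of "[x]" n w] by simp
      have cw: "?c \<in> carrier (Br n)" "?w \<in> carrier (Br n)"
        using Cons.prems by (auto simp: carrier_Br)
      have U: "br_act n ?w T \<in> carrier ?St" using cw T by simp
      have "g ?c \<otimes>\<^bsub>?G\<^esub> g ?w \<otimes>\<^bsub>?G\<^esub> f T = g ?c \<otimes>\<^bsub>?G\<^esub> f (br_act n ?w T) \<otimes>\<^bsub>?G\<^esub> g ?w"
        using Cons cw T by (simp add: F.m_assoc)
      also have "\<dots> = f (br_act n ?c (br_act n ?w T)) \<otimes>\<^bsub>?G\<^esub> (g ?c \<otimes>\<^bsub>?G\<^esub> g ?w)"
        using letter[OF _ U, of x] Cons.prems cw U by (simp add: F.m_assoc)
      finally show ?case
        unfolding xw using cw T by (simp add: br_act_mult[OF assms])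
    qed
    then show ?thesis using b by (auto simp: carrier_Br)
  qed

  define \<psi> where "\<psi> = (\<lambda>(T, b). f T \<otimes>\<^bsub>?G\<^esub> g b)"
  have \<psi>: "\<psi> \<in> hom ?SB ?G"
  proof (rule homI)
    fix p q assume "p \<in> carrier ?SB" "q \<in> carrier ?SB"
    then obtain T b T' b' where p: "p = (T, b)" "T \<in> carrier ?St" "b \<in> carrier (Br n)"
      and q: "q = (T', b')" "T' \<in> carrier ?St" "b' \<in> carrier (Br n)"
      by (auto simp: StBr_simps)
    have "f (br_act n b T') \<otimes>\<^bsub>?G\<^esub> (g b \<otimes>\<^bsub>?G\<^esub> g b') = g b \<otimes>\<^bsub>?G\<^esub> (f T' \<otimes>\<^bsub>?G\<^esub> g b')"
      using equiv_all[of b T'] p q by (simp flip: F.m_assoc)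
    then show "\<psi> (p \<otimes>\<^bsub>?SB\<^esub> q) = \<psi> p \<otimes>\<^bsub>?G\<^esub> \<psi> q"
      using p q by (simp add: \<psi>_def StBr_simps F.m_assoc)
  qed (auto simp: \<psi>_def StBr_simps)
  \<comment> \<open>On a generator the composite gives \<open>F.x \<alpha> a\<close> times
    \<open>F.y \<alpha>\<close>, which is the generator again.\<close>
  have \<psi>\<phi>: "\<psi> (\<phi> Z) = Z" if "Z \<in> carrier ?G" for Z
  proof -
    have "(\<psi> \<circ> \<phi>) Z = id Z"
    proof (rule presented_hom_eqI[of ?G "\<psi> \<circ> \<phi>" "BrA_gens n" "BrA_rels n" id])
      show "\<psi> \<circ> \<phi> \<in> hom (presented_group (BrA_gens n) (BrA_rels n)) ?G"
        using hom_compose[OF \<phi> \<psi>] by (simp add: BrA_def)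
      show "id \<in> hom (presented_group (BrA_gens n) (BrA_rels n)) ?G"
        by (simp add: hom_def BrA_def)
      show "(\<psi> \<circ> \<phi>) (pgen (BrA_gens n) (BrA_rels n) h) = id (pgen (BrA_gens n) (BrA_rels n) h)"
        if "h \<in> BrA_gens n" for h
        using that by (cases h) (simp add: \<phi>_gen \<psi>_def f_gen g_gen X_simple F.Y_eq[symmetric])
    qed (use that in \<open>simp_all add: BrA_def\<close>)
    then show ?thesis by simp
  qed

  have \<phi>_y: "\<phi> (F.y \<alpha>) = (\<one>\<^bsub>?St\<^esub>, ys n \<alpha>)" if "\<alpha> \<in> Delta n" for \<alpha>
    using that \<phi>_gen[of \<alpha> 0] by (simp add: F.y_def xs_zero)
  \<comment> \<open>For the other composite \<open>\<phi>\<close> must be known on \<open>X\<close>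
    at every root. Non-simple roots are accessible only through conjugation, hence the root
    induction; the equations are multiplied by \<open>\<phi>\<close> of some \<open>F.y\<close>,
    which is cancelled at the end.\<close>
  have \<phi>_X: "\<phi> (X \<gamma> a) = (xs n \<gamma> a, \<one>\<^bsub>Br n\<^esub>)" if "\<gamma> \<in> Dn n" for \<gamma> a
  proof -
    have pair: "(T, b) = (T, \<one>\<^bsub>Br n\<^esub>) \<otimes>\<^bsub>?SB\<^esub> (\<one>\<^bsub>?St\<^esub>, b)" "(T, \<one>\<^bsub>Br n\<^esub>) \<in> carrier ?SB" "(\<one>\<^bsub>?St\<^esub>, b) \<in> carrier ?SB"
      if "T \<in> carrier ?St" "b \<in> carrier (Br n)" for T b
      using that by (auto simp: StBr_simps br_act_one[OF assms])
    show ?thesis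
      using assms that
    proof (induction rule: root_induct)
      case (simple \<alpha>)
      have "\<phi> (F.x \<alpha> a) \<otimes>\<^bsub>?SB\<^esub> \<phi> (F.y \<alpha>) = (xs n \<alpha> a, \<one>\<^bsub>Br n\<^esub>) \<otimes>\<^bsub>?SB\<^esub> \<phi> (F.y \<alpha>)"
        using simple \<phi>_gen[of \<alpha> a] pair(1)[of "xs n \<alpha> a" "ys n \<alpha>"]
        by (simp add: F.Y_eq[of \<alpha> a] \<phi>_y)
      then show ?case
        using simple pair(2)[of "xs n \<alpha> a" "ys n \<alpha>"] by (simp add: X_simple)
    next
      case (reflect b u)
      have "X (refl n b u) a \<otimes>\<^bsub>?G\<^esub> F.y b = F.y b \<otimes>\<^bsub>?G\<^esub> X u a"
        using reflect by (simp add: equiv closed F.m_assoc)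
      then have "\<phi> (X (refl n b u) a) \<otimes>\<^bsub>?SB\<^esub> \<phi> (F.y b) = \<phi> (F.y b) \<otimes>\<^bsub>?SB\<^esub> \<phi> (X u a)"
        using reflect by (metis Dn(1) F.y_closed \<phi>.hom_mult closed refl_Dn)
      also have "\<dots> = (xs n (refl n b u) a, \<one>\<^bsub>Br n\<^esub>) \<otimes>\<^bsub>?SB\<^esub> \<phi> (F.y b)"
        using reflect pair(1)[of "xs n (refl n b u) a" "ys n b"]
        by (simp add: \<phi>_y) (simp add: StBr_simps br_act_pgen assms refl_Dn br_act_one)
      finally show ?case
        using reflect pair(2)[of "xs n (refl n b u) a" "ys n b"] by (simp add: closed refl_Dn)
    qed
  qed
  have \<phi>f: "\<phi> (f T) = (T, \<one>\<^bsub>Br n\<^esub>)" if "T \<in> carrier ?St" for T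
  proof -
    have "(\<phi> \<circ> f) T = (\<lambda>T. (T, \<one>\<^bsub>Br n\<^esub>)) T"
    proof (rule St_eqI[of ?SB "\<phi> \<circ> f" "\<lambda>T. (T, \<one>\<^bsub>Br n\<^esub>)"])
      show "\<phi> \<circ> f \<in> hom ?St ?SB" by (rule hom_compose[OF f \<phi>])
      show "(\<lambda>T. (T, \<one>\<^bsub>Br n\<^esub>)) \<in> hom ?St ?SB"
        by (rule homI) (auto simp: StBr_simps br_act_one[OF assms])
    qed (use that in \<open>auto simp: f_gen \<phi>_X\<close>)
    then show ?thesis by simp
  qed
  have \<phi>g: "\<phi> (g b) = (\<one>\<^bsub>?St\<^esub>, b)" if "b \<in> carrier (Br n)" for b
  proof -
    have one: "br_act n c \<one>\<^bsub>?St\<^esub> = \<one>\<^bsub>?St\<^esub>" if "c \<in> carrier (Br n)" for c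
      using hom_one[OF br_act_hom[OF assms that]] by simp
    have "(\<phi> \<circ> g) b = (\<lambda>b. (\<one>\<^bsub>?St\<^esub>, b)) b"
    proof (rule presented_hom_eqI[of ?SB "\<phi> \<circ> g" "Delta n" "Br_rels n" "\<lambda>b. (\<one>\<^bsub>?St\<^esub>, b)"])
      show "\<phi> \<circ> g \<in> hom (presented_group (Delta n) (Br_rels n)) ?SB"
        using hom_compose[OF g \<phi>] by (simp add: Br_def)
      have "(\<lambda>b. (\<one>\<^bsub>?St\<^esub>, b)) \<in> hom (Br n) ?SB"
        by (rule homI) (auto simp: StBr_simps one)
      then show "(\<lambda>b. (\<one>\<^bsub>?St\<^esub>, b)) \<in> hom (presented_group (Delta n) (Br_rels n)) ?SB"
        by (simp add: Br_def)
    qed (use that in \<open>auto simp: g_gen \<phi>_y Br_def\<close>)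
    then show ?thesis by simp
  qed
  have \<phi>\<psi>: "\<phi> (\<psi> p) = p" "\<psi> p \<in> carrier ?G" if mem: "p \<in> carrier ?SB" for p
  proof -
    obtain T b where p: "p = (T, b)" "T \<in> carrier ?St" "b \<in> carrier (Br n)"
      using mem by (auto simp: StBr_simps)
    show "\<psi> p \<in> carrier ?G" using p by (simp add: \<psi>_def)
    have "\<phi> (\<psi> p) = (T, \<one>\<^bsub>Br n\<^esub>) \<otimes>\<^bsub>?SB\<^esub> (\<one>\<^bsub>?St\<^esub>, b)"
      using p by (simp add: \<psi>_def \<phi>f \<phi>g)
    then show "\<phi> (\<psi> p) = p"
      using p by (simp add: StBr_simps br_act_one[OF assms])
  qed
  have "bij_betw \<phi> (carrier ?G) (carrier ?SB)"
    using \<psi>\<phi> \<phi>\<psi> by (intro bij_betw_byWitness[of _ \<psi>]) auto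
  then have "\<phi> \<in> iso ?G ?SB"
    using \<phi> by (simp add: iso_def)
  then show ?thesis using \<phi>_gen by blast
qed

end
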